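(* For every real $x$ with $0<x<1$, $$\int_0^x\pi u^2\cot(\pi u)\,du=-\left[\varsigma'(-2,x)+\varsigma'(-2,1-x)\right]+2x\left[\varsigma'(-1,x)-\varsigma'(-1,1-x)\right]+x^2\log(2\sin\pi x)-\frac{\varsigma(3)}{2\pi^2}.$$
   Context: $\varsigma(s)$ is the Riemann zeta function; $\varsigma(s,x)$ is the Hurwitz zeta function, i.e. the analytic continuation in $s$ (to $s\neq1$) of $\sum_{n=0}^{\infty}(n+x)^{-s}$, $x>0$; and $\varsigma'(s,x)=\frac{\partial}{\partial s}\varsigma(s,x)$. The integrand is understood to be extended continuously by $0$ at $u=0$. *)

theory Defs
  imports "HOL-Complex_Analysis.Complex_Analysis"
begin

text \<open>
  The value at \<open>s \<noteq> 1\<close> of the analytic continuation to the plane punctured at \<open>1\<close> of a function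
  \<open>F\<close> given on the half-plane \<open>Re w > 1\<close>. The value at \<open>s = 1\<close> is unspecified.
\<close>

definition continuation_off_1 :: "(complex \<Rightarrow> complex) \<Rightarrow> complex \<Rightarrow> complex" where
  "continuation_off_1 F s =
     (THE z. \<exists>f. f holomorphic_on (- {1}) \<and> (\<forall>w. Re w > 1 \<longrightarrow> f w = F w) \<and> z = f s)"

definition riemann_zeta :: "complex \<Rightarrow> complex" where
  "riemann_zeta s = continuation_off_1 (\<lambda>w. \<Sum>n. of_nat (Suc n) powr (- w)) s"

definition hurwitz_zeta :: "complex \<Rightarrow> real \<Rightarrow> complex" where
  "hurwitz_zeta s x = continuation_off_1 (\<lambda>w. \<Sum>n. (of_nat n + of_real x) powr (- w)) s"

definition hurwitz_zeta_deriv :: "complex \<Rightarrow> real \<Rightarrow> complex" where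
  "hurwitz_zeta_deriv s x = deriv (\<lambda>t. hurwitz_zeta t x) s"

lemma continuation_off_1_eq:
  assumes f: "f holomorphic_on (- {1})" "\<And>w. Re w > 1 \<Longrightarrow> f w = F w" and s: "s \<noteq> 1"
  shows "continuation_off_1 F s = f s"
  unfolding continuation_off_1_def
proof (rule the_equality)
  show "\<exists>g. g holomorphic_on (- {1}) \<and> (\<forall>w. Re w > 1 \<longrightarrow> g w = F w) \<and> f s = g s"
    using f by blast
next
  fix z
  assume "\<exists>g. g holomorphic_on (- {1}) \<and> (\<forall>w. Re w > 1 \<longrightarrow> g w = F w) \<and> z = g s"
  then obtain g where g: "g holomorphic_on (- {1})" "\<forall>w. Re w > 1 \<longrightarrow> g w = F w" "z = g s"
    by blast
  have "g s = f s"
  proof (rule analytic_continuation_open[where s = "{w. Re w > 1}" and s' = "- {1}" and f = g and g = f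
        and z = s])
    show "open {w :: complex. Re w > 1}"
      by (rule open_halfspace_Re_gt)
    show "open (- {1 :: complex})" and "s \<in> - {1}"
      using s by (simp_all add: open_Compl)
    have "2 \<in> {w :: complex. Re w > 1}"
      by simp
    then show "{w :: complex. Re w > 1} \<noteq> {}"
      by blast
    show "connected (- {1 :: complex})"
      by (rule connected_punctured_universe) simp
    show "{w :: complex. Re w > 1} \<subseteq> - {1}"
      by auto
    show "g z = f z" if "z \<in> {w. Re w > 1}" for z
      using that g(2) f(2) by simp
  qed (fact g(1) f(1))+
  then show "z = f s"
    by (simp add: \<open>z = g s\<close>)
qed

end

theory Submission
  imports Defs "HOL-Real_Asymp.Real_Asymp"
begin

text \<open>
  Write \<open>\<zeta>(s, x)\<close> for the Hurwitz zeta function, a prime for the derivative in \<open>s\<close>, and put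
  \<open>E(x) = \<zeta>'(-2, x) + \<zeta>'(-2, 1 - x)\<close> and \<open>O(x) = \<zeta>'(-1, x) - \<zeta>'(-1, 1 - x)\<close>. On \<open>(0, 1)\<close>
  \[ E' = 2 O, \qquad O' = - \log(2 \sin \pi x), \]
  so the right-hand side \<open>- E + 2 x O + x^2 log(2 sin \<pi>x) - \<zeta>(3) / (2\<pi>^2)\<close> has derivative
  \<open>\<pi> x^2 cot(\<pi>x)\<close>, and the theorem follows from the fundamental theorem of calculus once that side is
  known to tend to \<open>0\<close> as \<open>x\<close> decreases to \<open>0\<close>.

  The continuation of \<open>\<zeta>(s, x)\<close> is obtained from the identity
  \[ \zeta(s, x) = \frac{x^{1-s}}{s-1} + s \int_0^1 (1 - t)\, \zeta(s + 1, x + t)\, dt, \]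
  which holds for \<open>Re s > 1\<close> (\<open>hurwitz_series_recursion\<close>) and each use of which moves the boundary of
  the half-plane one unit to the left. It also gives the values of \<open>\<zeta>(0, x)\<close>, \<open>\<zeta>(-1, x)\<close> and
  \<open>\<zeta>(-2, 1)\<close>. The formulas for \<open>E'\<close> and \<open>O'\<close> come from \<open>\<partial>\<zeta>(s, x)/\<partial>x = - s \<zeta>(s + 1, x)\<close>,
  differentiated in \<open>s\<close> (\<open>has_vector_derivative_hurwitz_zeta_deriv\<close>); the terms without a derivative in
  \<open>s\<close> cancel by symmetry under \<open>x \<mapsto> 1 - x\<close>, and \<open>O'\<close> is then evaluated by Lerch's formula
  \<open>\<zeta>'(0, x) = log \<Gamma>(x) - log(2\<pi>) / 2\<close> (\<open>hurwitz_zeta_deriv_0\<close>) and the reflection formula for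
  \<open>\<Gamma>\<close>.

  The limit at \<open>0\<close> needs \<open>2 \<zeta>'(-2, 1) = - \<zeta>(3) / (2\<pi>^2)\<close> (\<open>hurwitz_zeta_deriv_neg2_1\<close>). The function
  \<open>- (\<Sum>n\<ge>1. cos(2\<pi>nx) / n^3) / (2\<pi>^2)\<close> has the same second derivative \<open>- 2 log(2 sin \<pi>x)\<close> as
  \<open>E\<close>, and both are symmetric about \<open>1/2\<close>, so they have equal increments between \<open>0\<close> and \<open>1/2\<close>
  (\<open>hurwitz_deriv_even_diff\<close>). The duplication formula \<open>\<zeta>(s, 1/2) + \<zeta>(s, 1) = 2^s \<zeta>(s, 1)\<close>
  expresses the increment of \<open>E\<close> by \<open>\<zeta>'(-2, 1)\<close> and that of the cosine series by \<open>\<zeta>(3)\<close>.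
\<close>

section \<open>Parameter integrals of holomorphic functions\<close>

text \<open>
  Cauchy's formula for the first derivative, with the circle parametrised by \<open>[0, 1]\<close>, so that
  continuity of parameter integrals applies to it.
\<close>

lemma deriv_circle_integral:
  fixes f :: "complex \<Rightarrow> complex"
  assumes "f holomorphic_on S" and "cball z r \<subseteq> S" and "w \<in> ball z r"
  shows "deriv f w = integral (cbox 0 1) (\<lambda>t::real. of_real r * exp (2 * of_real pi * \<i> * of_real t)
           * f (z + of_real r * exp (2 * of_real pi * \<i> * of_real t))
           / (z + of_real r * exp (2 * of_real pi * \<i> * of_real t) - w)\<^sup>2)"
proof -
  have "continuous_on (cball z r) f" "f holomorphic_on ball z r"
    using assms holomorphic_on_imp_continuous_on holomorphic_on_subset ball_subset_cball
    by (metis order_trans)+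
  from Cauchy_derivative_integral_circlepath(2)[OF this assms(3)]
  have "deriv f w = 1 / (2 * of_real pi * \<i>) * contour_integral (circlepath z r) (\<lambda>u. f u / (u - w)\<^sup>2)"
    by (rule DERIV_imp_deriv)
  also have "contour_integral (circlepath z r) (\<lambda>u. f u / (u - w)\<^sup>2)
     = integral {0..1} (\<lambda>t. f (circlepath z r t) / (circlepath z r t - w)\<^sup>2
         * (2 * pi * \<i> * r * exp (2 * of_real pi * \<i> * t)))"
    unfolding contour_integral_integral
    by (intro integral_cong) (simp add: vector_derivative_circlepath)
  also have "1 / (2 * of_real pi * \<i>) * \<dots> = integral {0..1} (\<lambda>t. 1 / (2 * of_real pi * \<i>) * 
      (f (circlepath z r t) / (circlepath z r t - w)\<^sup>2
         * (2 * pi * \<i> * r * exp (2 * of_real pi * \<i> * t))))"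
    by (rule integral_mult_right [symmetric])
  also have "\<dots> = integral {0..1} (\<lambda>t::real. of_real r * exp (2 * of_real pi * \<i> * of_real t)
           * f (z + of_real r * exp (2 * of_real pi * \<i> * of_real t))
           / (z + of_real r * exp (2 * of_real pi * \<i> * of_real t) - w)\<^sup>2)"
    by (intro integral_cong) (simp add: circlepath field_simps)
  finally show ?thesis by simp
qed

lemma continuous_on_deriv_param:
  fixes f :: "complex \<Rightarrow> 'a::metric_space \<Rightarrow> complex"
  assumes S: "open S" and cont: "continuous_on (S \<times> T) (\<lambda>(s, x). f s x)"
    and hol: "\<And>x. x \<in> T \<Longrightarrow> (\<lambda>s. f s x) holomorphic_on S"
  shows "continuous_on (S \<times> T) (\<lambda>(s, x). deriv (\<lambda>s. f s x) s)"
  unfolding continuous_on_eq_continuous_within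
proof
  fix p assume p: "p \<in> S \<times> T"
  define z where "z = fst p"
  have "z \<in> S" using p by (auto simp: z_def)
  then obtain r where r: "r > 0" "cball z r \<subseteq> S"
    using S open_contains_cball by blast
  define c where "c t = z + of_real r * exp (2 * of_real pi * \<i> * of_real t)" for t :: real
  have c_norm: "norm (c t - z) = r" for t
    using r by (simp add: c_def norm_mult)
  have c_S: "c t \<in> S" for t
    using c_norm[of t] r by (auto simp: subset_iff dist_norm norm_minus_commute)
  have c_ne: "c t \<noteq> w" if "w \<in> ball z r" for w t
    using c_norm[of t] that by (auto simp: dist_norm norm_minus_commute)
  have cc: "continuous_on A c" for A
    unfolding c_def by (intro continuous_intros)
  have eq: "deriv (\<lambda>s. f s x) w = integral (cbox 0 1) (\<lambda>t. of_real r * exp (2 * of_real pi * \<i> * of_real t)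
           * f (c t) x / (c t - w)\<^sup>2)" if "w \<in> ball z r" "x \<in> T" for w x
    using deriv_circle_integral[OF hol[OF that(2)] r(2) that(1)] by (simp add: c_def)
  have cf: "continuous_on ((ball z r \<times> T) \<times> cbox 0 (1::real)) (\<lambda>y. f (c (snd y)) (snd (fst y)))"
  proof -
    have "continuous_on ((ball z r \<times> T) \<times> cbox 0 (1::real)) 
        (\<lambda>y. (\<lambda>(s, x). f s x) (c (snd y), snd (fst y)))"
      by (rule continuous_on_compose2[OF cont])
         (auto intro!: continuous_intros continuous_on_compose2[OF cc] simp: c_S)
    then show ?thesis by simp
  qed
  define g where "g y t = of_real r * exp (2 * of_real pi * \<i> * of_real t)
           * f (c t) (snd y) / (c t - fst y)\<^sup>2" for y :: "complex \<times> 'a" and t :: real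
  have "continuous_on ((ball z r \<times> T) \<times> cbox 0 (1::real)) (\<lambda>(y, t). g y t)"
    unfolding g_def split_beta
    by (intro continuous_intros continuous_on_compose2[OF cc] cf) (auto simp: c_ne)
  then have "continuous_on (ball z r \<times> T) (\<lambda>y. integral (cbox 0 1) (g y))"
    by (rule integral_continuous_on_param)
  then have "continuous_on (ball z r \<times> T) (\<lambda>(s, x). deriv (\<lambda>s. f s x) s)"
    by (rule continuous_on_cong[THEN iffD1, rotated 2]) (auto simp: eq g_def intro!: integral_cong)
  then have "continuous (at p within (ball z r \<times> T)) (\<lambda>(s, x). deriv (\<lambda>s. f s x) s)"
    unfolding continuous_on_eq_continuous_within using p r by (cases p) (simp add: z_def mem_Times_iff split: prod.splits)
  moreover have "at p within (ball z r \<times> T) = at p within (S \<times> T)"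
    by (rule at_within_nhd[of _ "ball z r \<times> UNIV"])
       (use p r in \<open>auto simp: z_def mem_Times_iff intro!: open_Times dest: subsetD\<close>)
  ultimately show "continuous (at p within (S \<times> T)) (\<lambda>(s, x). deriv (\<lambda>s. f s x) s)"
    by simp
qed

lemma has_field_derivative_integral_param:
  fixes f :: "complex \<Rightarrow> real \<Rightarrow> complex"
  assumes S: "open S" and cont: "continuous_on (S \<times> {a..b}) (\<lambda>(s, t). f s t)"
    and hol: "\<And>t. t \<in> {a..b} \<Longrightarrow> (\<lambda>s. f s t) holomorphic_on S" and s: "s \<in> S"
  shows "((\<lambda>s. integral {a..b} (f s)) has_field_derivative
           integral {a..b} (\<lambda>t. deriv (\<lambda>s. f s t) s)) (at s)"
proof -
  obtain r where r: "r > 0" "ball s r \<subseteq> S"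
    using S s open_contains_ball by blast
  have "((\<lambda>s. integral (cbox a b) (f s)) has_field_derivative
           integral (cbox a b) (\<lambda>t. deriv (\<lambda>s. f s t) s)) (at s within ball s r)"
  proof (rule leibniz_rule_field_derivative[where U = "ball s r" and fx = "\<lambda>s t. deriv (\<lambda>s. f s t) s"])
    fix w t assume w: "w \<in> ball s r" and t: "t \<in> cbox a b"
    have "(\<lambda>s. f s t) holomorphic_on ball s r"
      using hol r t holomorphic_on_subset by fastforce
    then show "((\<lambda>s. f s t) has_field_derivative deriv (\<lambda>s. f s t) w) (at w within ball s r)"
      using w by (meson holomorphic_derivI open_ball has_field_derivative_at_within)
  next
    fix w assume w: "w \<in> ball s r"
    have "continuous_on (cbox a b) (\<lambda>t. (\<lambda>(s, t). f s t) (w, t))"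
      by (rule continuous_on_compose2[OF cont]) (use w r in \<open>auto intro!: continuous_intros\<close>)
    then show "f w integrable_on cbox a b"
      by (intro integrable_continuous) simp
  next
    show "continuous_on (ball s r \<times> cbox a b) (\<lambda>(s, t). deriv (\<lambda>s. f s t) s)"
      by (rule continuous_on_subset[OF continuous_on_deriv_param[OF S cont hol]]) (use r in auto)
  qed (use r in auto)
  then show ?thesis using r by (simp add: at_within_open[of s "ball s r"])
qed

lemma holomorphic_on_integral_param:
  fixes f :: "complex \<Rightarrow> real \<Rightarrow> complex"
  assumes "open S" and "continuous_on (S \<times> {a..b}) (\<lambda>(s, t). f s t)"
    and "\<And>t. t \<in> {a..b} \<Longrightarrow> (\<lambda>s. f s t) holomorphic_on S"
  shows "(\<lambda>s. integral {a..b} (f s)) holomorphic_on S"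
  using has_field_derivative_integral_param[OF assms] assms(1)
  by (metis holomorphic_on_open)

section \<open>The Hurwitz series and its recursion\<close>

lemma of_real_powr_exp: "x > 0 \<Longrightarrow> complex_of_real x powr s = exp (s * of_real (ln x))"
  by (simp add: powr_def Ln_of_real)

lemma norm_of_real_powr: "x > 0 \<Longrightarrow> norm (complex_of_real x powr s) = x powr Re s"
  by (simp add: norm_powr_real_powr)

lemma continuous_on_of_real_powr:
  assumes "continuous_on A f" "continuous_on A g" "\<And>x. x \<in> A \<Longrightarrow> g x > 0"
  shows "continuous_on A (\<lambda>x. complex_of_real (g x) powr f x)"
proof -
  have "continuous_on A (\<lambda>x. exp (f x * of_real (ln (g x))))"
    using assms by (intro continuous_intros) (auto dest: order_less_imp_not_eq2)
  then show ?thesis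
    by (rule continuous_on_cong[THEN iffD1, rotated 2]) (simp_all add: of_real_powr_exp assms(3))
qed

text \<open>
  A family of functions holomorphic on the open set \<open>S\<close>, indexed by a positive real parameter and
  jointly continuous in both arguments. By Cauchy's formula the derivative in \<open>s\<close> is then jointly
  continuous as well, which is what differentiation under the integral sign requires.
\<close>

definition holomorphic_family :: "complex set \<Rightarrow> (complex \<Rightarrow> real \<Rightarrow> complex) \<Rightarrow> bool" where
  "holomorphic_family S f \<longleftrightarrow> open S \<and> continuous_on (S \<times> {0<..}) (\<lambda>(s, x). f s x)
     \<and> (\<forall>x>0. (\<lambda>s. f s x) holomorphic_on S)"

lemma holomorphic_familyD:
  assumes "holomorphic_family S f"
  shows "open S" "continuous_on (S \<times> {0<..}) (\<lambda>(s, x). f s x)"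
    "x > 0 \<Longrightarrow> (\<lambda>s. f s x) holomorphic_on S"
  using assms by (auto simp: holomorphic_family_def)

lemma holomorphic_family_compose:
  assumes "holomorphic_family S f" "continuous_on A g" "continuous_on A h"
    and "\<And>y. y \<in> A \<Longrightarrow> g y \<in> S" "\<And>y. y \<in> A \<Longrightarrow> h y > 0"
  shows "continuous_on A (\<lambda>y. f (g y) (h y))"
proof -
  have "continuous_on A (\<lambda>y. (\<lambda>(s, x). f s x) (g y, h y))"
    by (rule continuous_on_compose2[OF holomorphic_familyD(2)[OF assms(1)]])
       (use assms in \<open>auto intro!: continuous_intros\<close>)
  then show ?thesis by simp
qed

lemma holomorphic_family_deriv_compose:
  assumes "holomorphic_family S f" "continuous_on A g" "continuous_on A h"
    and "\<And>y. y \<in> A \<Longrightarrow> g y \<in> S" "\<And>y. y \<in> A \<Longrightarrow> h y > 0"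
  shows "continuous_on A (\<lambda>y. deriv (\<lambda>s. f s (h y)) (g y))"
proof -
  have "continuous_on A (\<lambda>y. (\<lambda>(s, x). deriv (\<lambda>s. f s x) s) (g y, h y))"
    by (rule continuous_on_compose2[OF continuous_on_deriv_param])
       (use assms holomorphic_familyD[OF assms(1)] in \<open>auto intro!: continuous_intros\<close>)
  then show ?thesis by simp
qed

lemma holomorphic_family_powr:
  assumes "open S" "a holomorphic_on S"
  shows "holomorphic_family S (\<lambda>s x. of_real x powr a s)"
  unfolding holomorphic_family_def split_beta
proof (intro conjI allI impI)
  show "continuous_on (S \<times> {0<..}) (\<lambda>p. complex_of_real (snd p) powr a (fst p))"
    by (intro continuous_on_of_real_powr continuous_on_compose2[OF holomorphic_on_imp_continuous_on[OF assms(2)]]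
         continuous_intros) auto
  show "(\<lambda>s. complex_of_real x powr a s) holomorphic_on S" if "x > 0" for x
    unfolding of_real_powr_exp[OF that] by (intro holomorphic_intros assms)
qed fact

lemma holomorphic_family_mult:
  assumes "a holomorphic_on S" "holomorphic_family S f"
  shows "holomorphic_family S (\<lambda>s x. a s * f s x)"
  unfolding holomorphic_family_def split_beta
  using holomorphic_familyD[OF assms(2)] assms(1)
  by (auto intro!: continuous_intros holomorphic_intros simp: split_beta
       intro: continuous_on_compose2[OF holomorphic_on_imp_continuous_on[OF assms(1)]])

lemma holomorphic_family_add:
  assumes "holomorphic_family S f" "holomorphic_family S g"
  shows "holomorphic_family S (\<lambda>s x. f s x + g s x)"
  unfolding holomorphic_family_def split_beta
  using holomorphic_familyD[OF assms(1)] holomorphic_familyD[OF assms(2)]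
  by (auto intro!: continuous_intros holomorphic_intros simp: split_beta)

lemma holomorphic_family_shift:
  assumes "holomorphic_family S f" "open S'" "\<And>s. s \<in> S' \<Longrightarrow> s + 1 \<in> S"
  shows "holomorphic_family S' (\<lambda>s x. f (s + 1) x)"
proof -
  have "(\<lambda>s. f (s + 1) x) holomorphic_on S'" if "x > 0" for x
  proof -
    have "((\<lambda>s. f s x) \<circ> (\<lambda>s. s + 1)) holomorphic_on S'"
      by (rule holomorphic_on_compose_gen[of _ _ _ S])
         (use assms holomorphic_familyD[OF assms(1)] that in \<open>auto intro!: holomorphic_intros\<close>)
    then show ?thesis by (simp add: o_def)
  qed
  moreover have "continuous_on (S' \<times> {0<..}) (\<lambda>p. f (fst p + 1) (snd p))"
    by (rule holomorphic_family_compose[OF assms(1)]) (use assms in \<open>auto intro!: continuous_intros\<close>)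
  ultimately show ?thesis using assms(2) by (simp add: holomorphic_family_def split_beta)
qed

lemma holomorphic_family_integral:
  assumes f: "holomorphic_family S f"
  shows "holomorphic_family S (\<lambda>s x. integral {0..1} (\<lambda>t. of_real (1 - t) * f s (x + t)))"
proof -
  have "continuous_on (S \<times> {0<..}) (\<lambda>p. integral (cbox 0 1) (\<lambda>t. of_real (1 - t) * f (fst p) (snd p + t)))"
  proof (rule integral_continuous_on_param)
    show "continuous_on ((S \<times> {0<..}) \<times> cbox 0 (1::real))
            (\<lambda>(p, t). complex_of_real (1 - t) * f (fst p) (snd p + t))"
      unfolding split_beta
      by (intro continuous_intros holomorphic_family_compose[OF f]) auto
  qed
  moreover have "(\<lambda>s. integral {0..1} (\<lambda>t. of_real (1 - t) * f s (x + t))) holomorphic_on S" if "x > 0" for x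
  proof (rule holomorphic_on_integral_param)
    show "continuous_on (S \<times> {0..1}) (\<lambda>(s, t). complex_of_real (1 - t) * f s (x + t))"
      unfolding split_beta
      by (intro continuous_intros holomorphic_family_compose[OF f]) (use that in auto)
    show "(\<lambda>s. complex_of_real (1 - t) * f s (x + t)) holomorphic_on S" if "t \<in> {0..1}" for t
      using that \<open>x > 0\<close> by (intro holomorphic_intros holomorphic_familyD(3)[OF f]) auto
  qed (rule holomorphic_familyD(1)[OF f])
  ultimately show ?thesis
    using holomorphic_familyD(1)[OF f] by (simp add: holomorphic_family_def split_beta)
qed

text \<open>
  The Dirichlet series of the Hurwitz zeta function; it is meaningful for \<open>Re s > 1\<close> and \<open>x > 0\<close>.
\<close>

definition hurwitz_series :: "complex \<Rightarrow> real \<Rightarrow> complex" where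
  "hurwitz_series s x = (\<Sum>n. of_real (real n + x) powr (- s))"

text \<open>
  The terms with \<open>n \<ge> 1\<close> are bounded by \<open>n powr - (1 + \<delta>)\<close> independently of \<open>x > 0\<close>. The remaining
  term \<open>n = 0\<close>, unbounded as \<open>x\<close> tends to \<open>0\<close>, occurs in every nonempty partial sum and so does not
  affect the convergence.
\<close>

lemma uniform_limit_hurwitz_series:
  assumes "\<delta> > 0"
  shows "uniform_limit ({s. Re s \<ge> 1 + \<delta>} \<times> {0<..})
     (\<lambda>N p. \<Sum>n<N. of_real (real n + snd p) powr (- fst p)) (\<lambda>p. hurwitz_series (fst p) (snd p)) sequentially"
  unfolding hurwitz_series_def
proof (rule Weierstrass_m_test_ev)
  show "summable (\<lambda>n. real n powr (- (1 + \<delta>)))"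
    using assms by (simp add: summable_real_powr_iff)
  show "eventually (\<lambda>n. \<forall>p\<in>{s. Re s \<ge> 1 + \<delta>} \<times> {0<..}.
      norm (complex_of_real (real n + snd p) powr (- fst p)) \<le> real n powr (- (1 + \<delta>))) sequentially"
    using eventually_ge_at_top[of 1]
  proof (eventually_elim, safe)
    fix n :: nat and s :: complex and x :: real assume n: "1 \<le> n" and s: "1 + \<delta> \<le> Re s" and x: "(0::real) < x"
    have "norm (complex_of_real (real n + x) powr (- s)) = (real n + x) powr (- Re s)"
      using n x by (subst norm_of_real_powr) auto
    also have "\<dots> \<le> real n powr (- Re s)"
      using n x s assms by (intro powr_mono2') auto
    also have "\<dots> \<le> real n powr (- (1 + \<delta>))"
      using n s by (intro powr_mono) simp_all
    finally show "norm (complex_of_real (real n + snd (s, x)) powr (- fst (s, x))) \<le> real n powr (- (1 + \<delta>))"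
      by simp
  qed
qed

lemma sums_hurwitz_series:
  assumes "Re s > 1" "x > 0"
  shows "(\<lambda>n. of_real (real n + x) powr (- s)) sums hurwitz_series s x"
  using tendsto_uniform_limitI[OF uniform_limit_hurwitz_series[of "Re s - 1"], of "(s, x)"] assms
  by (simp add: sums_def)

lemma holomorphic_family_hurwitz_series: "holomorphic_family {s. Re s > 1} hurwitz_series"
  unfolding holomorphic_family_def split_beta
proof (intro conjI allI impI)
  show op: "open {s. Re s > 1}" by (rule open_halfspace_Re_gt)
  have c: "continuous_on ({s. Re s > 1 + \<delta>} \<times> {0<..}) (\<lambda>p. hurwitz_series (fst p) (snd p))"
    if "\<delta> > 0" for \<delta>
    by (rule uniform_limit_theorem[OF _ uniform_limit_on_subset[OF uniform_limit_hurwitz_series[OF that]]])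
       (simp_all del: of_real_add, intro always_eventually allI continuous_on_sum continuous_on_of_real_powr
          continuous_intros, auto)
  have "continuous_on (\<Union>\<delta>\<in>{0<..}. {s. Re s > 1 + \<delta>} \<times> {0<..}) (\<lambda>p. hurwitz_series (fst p) (snd p))"
    by (rule continuous_on_open_UN) (auto intro!: c open_Times open_halfspace_Re_gt)
  moreover have "(\<Union>\<delta>\<in>{0<..}. {s. Re s > 1 + \<delta>} \<times> {0<..}) = {s. Re s > 1} \<times> {0::real<..}" (is "?A = ?B")
  proof
    show "?B \<subseteq> ?A"
    proof safe
      fix s :: complex and x :: real assume "1 < Re s" "0 < x"
      then show "(s, x) \<in> ?A" by (intro UN_I[of "(Re s - 1) / 2"]) (auto simp: field_simps)
    qed
  qed auto
  ultimately show "continuous_on ({s. Re s > 1} \<times> {0<..}) (\<lambda>p. hurwitz_series (fst p) (snd p))"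
    by simp
  fix x :: real assume x: "x > 0"
  show "(\<lambda>s. hurwitz_series s x) holomorphic_on {s. Re s > 1}"
  proof (rule holomorphic_uniform_sequence[OF op])
    show "(\<lambda>s. \<Sum>n<N. of_real (real n + x) powr (- s)) holomorphic_on {s. Re s > 1}" for N
      using x by (auto intro!: holomorphic_intros)
    fix s assume s: "s \<in> {s. Re s > 1}"
    define \<delta> where "\<delta> = (Re s - 1) / 2"
    have \<delta>: "\<delta> > 0" using s by (simp add: \<delta>_def)
    have sub: "cball s \<delta> \<subseteq> {s. Re s \<ge> 1 + \<delta>}"
    proof
      fix w assume "w \<in> cball s \<delta>"
      then have "\<bar>Re (s - w)\<bar> \<le> \<delta>"
        using abs_Re_le_cmod[of "s - w"] by (simp add: dist_norm)
      then have "Re s - Re w \<le> \<delta>" by (simp add: abs_le_iff)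
      then show "w \<in> {s. Re s \<ge> 1 + \<delta>}" by (simp add: \<delta>_def field_simps)
    qed
    have "uniform_limit (cball s \<delta>) (\<lambda>N w. \<Sum>n<N. of_real (real n + snd (w, x)) powr (- fst (w, x)))
       (\<lambda>w. hurwitz_series (fst (w, x)) (snd (w, x))) sequentially"
      by (rule uniform_limit_compose'[OF uniform_limit_hurwitz_series[OF \<delta>]]) (use sub x in auto)
    then show "\<exists>d>0. cball s d \<subseteq> {s. Re s > 1} \<and>
       uniform_limit (cball s d) (\<lambda>N w. \<Sum>n<N. of_real (real n + x) powr (- w))
         (\<lambda>w. hurwitz_series w x) sequentially"
      using \<delta> sub by (intro exI[of _ \<delta>]) auto
  qed
qed

text \<open>
  One summand of the recursion: integration by parts in \<open>s (1 - t) (y + t)^{-s-1}\<close>.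
\<close>

lemma has_integral_powr_parts:
  fixes y :: real and s :: complex
  assumes y: "y > 0" and s: "s \<noteq> 1"
  shows "((\<lambda>t. s * (of_real (1 - t) * of_real (y + t) powr (- (s + 1)))) has_integral
     (of_real y powr (- s) - (of_real y powr (1 - s) - of_real (y + 1) powr (1 - s)) / (s - 1))) {0..1}"
proof -
  define F where "F t = - of_real (1 - t) * of_real (y + t) powr (- s) - of_real (y + t) powr (1 - s) / (1 - s)" for t
  have "((\<lambda>t. s * (of_real (1 - t) * of_real (y + t) powr (- (s + 1)))) has_integral (F 1 - F 0)) {0..1}"
  proof (rule fundamental_theorem_of_calculus)
    fix t :: real assume t: "t \<in> {0..1}"
    have nz: "of_real y + of_real t \<noteq> (0::complex)" and np: "of_real y + complex_of_real t \<notin> \<real>\<^sub>\<le>\<^sub>0"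
      using y t by (auto simp flip: of_real_add)
    have "((\<lambda>w::complex. - (1 - w) * (of_real y + w) powr (- s) - (of_real y + w) powr (1 - s) / (1 - s))
        has_field_derivative s * ((1 - of_real t) * (of_real y + of_real t) powr (- (s + 1)))) (at (of_real t))"
    proof -
      have D: "((\<lambda>w. (of_real y + w) powr a) has_field_derivative a * (of_real y + of_real t) powr (a - 1)) (at (of_real t))"
        for a :: complex
      proof -
        have "((\<lambda>w. complex_of_real y + w) has_field_derivative 1) (at (of_real t))"
          by (auto intro!: derivative_eq_intros)
        from DERIV_chain2[OF has_field_derivative_powr[OF np] this] show ?thesis by simp
      qed
      have e: "- s - 1 = - (s + 1)" "1 - s - 1 = - s" by auto
      have "((\<lambda>w::complex. - (1 - w)) has_field_derivative 1) (at (of_real t))"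
        by (auto intro!: derivative_eq_intros)
      from DERIV_diff[OF DERIV_mult[OF this D[of "- s"]] DERIV_cdivide[OF D[of "1 - s"], of "1 - s"]]
      show ?thesis
        unfolding e by (rule DERIV_cong) (use s in \<open>simp add: field_simps\<close>)
    qed
    then have "((\<lambda>t. - (1 - of_real t) * (of_real y + of_real t) powr (- s) - (of_real y + of_real t) powr (1 - s) / (1 - s))
        has_vector_derivative s * ((1 - of_real t) * (of_real y + of_real t) powr (- (s + 1)))) (at t within {0..1})"
      by (rule has_vector_derivative_real_field)
    then show "(F has_vector_derivative s * (of_real (1 - t) * of_real (y + t) powr (- (s + 1)))) (at t within {0..1})"
      by (simp add: F_def[abs_def])
  qed simp
  moreover have "F 1 - F 0 = of_real y powr (- s) - (of_real y powr (1 - s) - of_real (y + 1) powr (1 - s)) / (s - 1)"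
  proof -
    have "a / (1 - s) = - (a / (s - 1))" for a
      by (simp add: minus_divide_right)
    then show ?thesis by (simp add: F_def diff_divide_distrib)
  qed
  ultimately show ?thesis by simp
qed

lemma tendsto_of_real_powr_0:
  assumes "Re s < 0"
  shows "(\<lambda>N. complex_of_real (real N + x) powr s) \<longlonglongrightarrow> 0"
proof (rule Lim_null_comparison)
  show "eventually (\<lambda>N. norm (complex_of_real (real N + x) powr s) \<le> (real N + x) powr Re s) sequentially"
    using eventually_gt_at_top[of "nat \<lceil>\<bar>x\<bar>\<rceil>"]
    by eventually_elim (subst norm_of_real_powr, linarith, simp)
  show "(\<lambda>N. (real N + x) powr Re s) \<longlonglongrightarrow> 0"
    using assms by (intro tendsto_neg_powr filterlim_tendsto_add_at_top[OF tendsto_const filterlim_real_sequentially, of x, unfolded add.commute[of x]])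
qed

lemma hurwitz_series_recursion:
  assumes s: "Re s > 1" and x: "x > 0"
  shows "hurwitz_series s x = of_real x powr (1 - s) / (s - 1)
           + s * integral {0..1} (\<lambda>t. of_real (1 - t) * hurwitz_series (s + 1) (x + t))"
proof -
  define f where "f n t = s * (of_real (1 - t) * of_real (real n + (x + t)) powr (- (s + 1)))" for n t
  define g where "g t = s * (of_real (1 - t) * hurwitz_series (s + 1) (x + t))" for t
  have s1: "s \<noteq> 1" using s by auto
  have f_int: "(f n has_integral of_real (real n + x) powr (- s)
     - (of_real (real n + x) powr (1 - s) - of_real (real (Suc n) + x) powr (1 - s)) / (s - 1)) {0..1}" for n
    using has_integral_powr_parts[of "real n + x" s] x s1 by (simp add: f_def[abs_def] add_ac)
  have f_int: "((\<lambda>t. \<Sum>n<N. f n t) has_integral (\<Sum>n<N. of_real (real n + x) powr (- s))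
     - (of_real x powr (1 - s) - of_real (real N + x) powr (1 - s)) / (s - 1)) {0..1}" for N
  proof -
    have "((\<lambda>t. \<Sum>n<N. f n t) has_integral (\<Sum>n<N. of_real (real n + x) powr (- s)
     - (of_real (real n + x) powr (1 - s) - of_real (real (Suc n) + x) powr (1 - s)) / (s - 1))) {0..1}"
      by (intro has_integral_sum f_int) auto
    also have "(\<Sum>n<N. of_real (real n + x) powr (- s)
     - (of_real (real n + x) powr (1 - s) - of_real (real (Suc n) + x) powr (1 - s)) / (s - 1))
      = (\<Sum>n<N. of_real (real n + x) powr (- s))
       - (\<Sum>n<N. of_real (real n + x) powr (1 - s) - of_real (real (Suc n) + x) powr (1 - s)) / (s - 1)"
      by (simp only: sum_subtractf sum_divide_distrib diff_divide_distrib)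
    also have "(\<Sum>n<N. complex_of_real (real n + x) powr (1 - s) - of_real (real (Suc n) + x) powr (1 - s))
       = of_real x powr (1 - s) - of_real (real N + x) powr (1 - s)"
      using sum_lessThan_telescope'[of "\<lambda>n. complex_of_real (real n + x) powr (1 - s)" N] by simp
    finally show ?thesis .
  qed
  have "uniform_limit {0..1} (\<lambda>N t. \<Sum>n<N. of_real (real n + snd (s + 1, x + t)) powr (- fst (s + 1, x + t)))
     (\<lambda>t. hurwitz_series (fst (s + 1, x + t)) (snd (s + 1, x + t))) sequentially"
    by (rule uniform_limit_compose'[OF uniform_limit_hurwitz_series[of 1]]) (use s x in auto)
  then have lim: "uniform_limit {0..1} (\<lambda>N t. \<Sum>n<N. of_real (real n + (x + t)) powr (- (s + 1)))
     (\<lambda>t. hurwitz_series (s + 1) (x + t)) sequentially"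
    by simp
  have "continuous_on {0..1} (\<lambda>t. hurwitz_series (s + 1) (x + t))"
    by (rule holomorphic_family_compose[OF holomorphic_family_hurwitz_series])
       (use s x in \<open>auto intro!: continuous_intros\<close>)
  then have bdd1: "bounded ((\<lambda>t. hurwitz_series (s + 1) (x + t)) ` {0..1})"
    by (intro compact_imp_bounded compact_continuous_image) auto
  have bdd2: "bounded ((\<lambda>t. complex_of_real (1 - t)) ` {0..1})"
    by (intro compact_imp_bounded compact_continuous_image) (auto intro!: continuous_intros)
  have "uniform_limit {0..1} (\<lambda>N t. of_real (1 - t) * (\<Sum>n<N. of_real (real n + (x + t)) powr (- (s + 1))))
     (\<lambda>t. of_real (1 - t) * hurwitz_series (s + 1) (x + t)) sequentially"
    by (rule uniform_lim_mult[OF uniform_limit_const lim bdd2 bdd1])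
  then have "uniform_limit {0..1} (\<lambda>N t. s * (of_real (1 - t) * (\<Sum>n<N. of_real (real n + (x + t)) powr (- (s + 1))))) g sequentially"
    unfolding g_def by (rule bounded_linear.uniform_limit[OF bounded_linear_mult_right])
  then have "uniform_limit {0..1} (\<lambda>N t. \<Sum>n<N. f n t) g sequentially"
    by (simp add: f_def sum_distrib_left)
  moreover have "continuous_on {0..1} (\<lambda>t. \<Sum>n<N. f n t)" for N
    unfolding f_def using x
    by (intro continuous_intros continuous_on_of_real_powr) auto
  ultimately obtain I J where IJ: "\<And>N. ((\<lambda>t. \<Sum>n<N. f n t) has_integral I N) {0..1}"
     "(g has_integral J) {0..1}" "I \<longlonglongrightarrow> J"
    using uniform_limit_integral[where a = 0 and b = 1 and f = "\<lambda>N t. \<Sum>n<N. f n t" and g = g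
          and F = sequentially] by auto
  have I: "I N = (\<Sum>n<N. of_real (real n + x) powr (- s))
     - (of_real x powr (1 - s) - of_real (real N + x) powr (1 - s)) / (s - 1)" for N
    using has_integral_unique[OF IJ(1) f_int] .
  have "I \<longlonglongrightarrow> hurwitz_series s x - (of_real x powr (1 - s) - 0) / (s - 1)"
    unfolding I using sums_hurwitz_series[OF s x] s1 s
    by (intro tendsto_intros tendsto_of_real_powr_0) (auto simp: sums_def)
  then have "J = hurwitz_series s x - of_real x powr (1 - s) / (s - 1)"
    using IJ(3) LIMSEQ_unique by fastforce
  moreover have "J = s * integral {0..1} (\<lambda>t. of_real (1 - t) * hurwitz_series (s + 1) (x + t))"
    using integral_unique[OF IJ(2)] by (simp add: g_def[abs_def])
  ultimately show ?thesis by simp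
qed

section \<open>Analytic continuation of the Hurwitz series\<close>

text \<open>
  The regular part \<open>\<zeta>(s, x) - x^{1-s} / (s - 1)\<close>. Step \<open>0\<close> defines it by the series for \<open>Re s > 1\<close>,
  and step \<open>N\<close> extends it to \<open>Re s > 1 - N\<close>. Subtracting \<open>x^{1-s} / (s - 1)\<close>, and not only the
  principal part \<open>1 / (s - 1)\<close>, makes the recursion free of poles: the pole of
  \<open>(x + t)^{-s} / s\<close>, the subtracted part of \<open>\<zeta>(s + 1, x + t)\<close>, is cancelled by the factor \<open>s\<close>.
\<close>

primrec hurwitz_reg :: "nat \<Rightarrow> complex \<Rightarrow> real \<Rightarrow> complex" where
  "hurwitz_reg 0 s x = hurwitz_series s x - of_real x powr (1 - s) / (s - 1)"
| "hurwitz_reg (Suc N) s x = integral {0..1} (\<lambda>t. of_real (1 - t) * of_real (x + t) powr (- s))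
     + s * integral {0..1} (\<lambda>t. of_real (1 - t) * hurwitz_reg N (s + 1) (x + t))"

lemma holomorphic_family_hurwitz_reg: "holomorphic_family {s. Re s > 1 - real N} (hurwitz_reg N)"
proof (induction N)
  case 0
  have "holomorphic_family {s. Re s > 1} (\<lambda>s x. hurwitz_series s x + (- 1 / (s - 1)) * of_real x powr (1 - s))"
    by (intro holomorphic_family_add holomorphic_family_mult holomorphic_family_hurwitz_series
         holomorphic_family_powr open_halfspace_Re_gt holomorphic_intros) auto
  also have "(\<lambda>s x. hurwitz_series s x + (- 1 / (s - 1)) * of_real x powr (1 - s)) = hurwitz_reg 0"
    by (auto simp: fun_eq_iff)
  finally show ?case by simp
next
  case (Suc N)
  have op: "open {s. Re s > 1 - real (Suc N)}"
    by (rule open_halfspace_Re_gt)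
  have "holomorphic_family {s. Re s > 1 - real (Suc N)} (\<lambda>s x.
     integral {0..1} (\<lambda>t. of_real (1 - t) * of_real (x + t) powr (- s))
     + s * integral {0..1} (\<lambda>t. of_real (1 - t) * hurwitz_reg N (s + 1) (x + t)))"
    by (intro holomorphic_family_add holomorphic_family_mult holomorphic_family_integral
         holomorphic_family_powr op holomorphic_intros holomorphic_family_shift[OF Suc.IH]) auto
  also have "(\<lambda>s x. integral {0..1} (\<lambda>t. of_real (1 - t) * of_real (x + t) powr (- s))
     + s * integral {0..1} (\<lambda>t. of_real (1 - t) * hurwitz_reg N (s + 1) (x + t))) = hurwitz_reg (Suc N)"
    by (auto simp: fun_eq_iff)
  finally show ?case .
qed

lemma hurwitz_reg_Suc_eq:
  "x > 0 \<Longrightarrow> Re s > 1 - real N \<Longrightarrow> hurwitz_reg (Suc N) s x = hurwitz_reg N s x"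
proof (induction N arbitrary: s x)
  case 0
  then have s: "s \<noteq> 0" "s \<noteq> 1" "Re s > 1" by auto
  have "hurwitz_reg 0 (s + 1) y = hurwitz_series (s + 1) y - of_real y powr (- s) / s" for y
    by simp
  then have "s * integral {0..1} (\<lambda>t. of_real (1 - t) * hurwitz_reg 0 (s + 1) (x + t))
    = s * integral {0..1} (\<lambda>t. of_real (1 - t) * hurwitz_series (s + 1) (x + t)
          - of_real (1 - t) * of_real (x + t) powr (- s) / s)"
    by (simp only: right_diff_distrib times_divide_eq_right)
  also have "\<dots> = s * (integral {0..1} (\<lambda>t. of_real (1 - t) * hurwitz_series (s + 1) (x + t))
          - integral {0..1} (\<lambda>t. of_real (1 - t) * of_real (x + t) powr (- s) / s))"
    using 0 s
    by (subst integral_diff) (auto intro!: integrable_continuous_interval continuous_intros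
       continuous_on_of_real_powr holomorphic_family_compose[OF holomorphic_family_hurwitz_series] simp del: of_real_add)
  also have "\<dots> = s * integral {0..1} (\<lambda>t. of_real (1 - t) * hurwitz_series (s + 1) (x + t))
          - integral {0..1} (\<lambda>t. of_real (1 - t) * of_real (x + t) powr (- s))"
    using s by (simp add: right_diff_distrib)
  finally show ?case
    using hurwitz_series_recursion[of s x] 0 s by simp
next
  case (Suc N)
  have "integral {0..1} (\<lambda>t. of_real (1 - t) * hurwitz_reg (Suc N) (s + 1) (x + t))
      = integral {0..1} (\<lambda>t. of_real (1 - t) * hurwitz_reg N (s + 1) (x + t))"
    using Suc.prems by (intro integral_cong) (simp del: hurwitz_reg.simps add: Suc.IH)
  then show ?case by simp
qed

lemma hurwitz_reg_eq:
  assumes "N \<le> M" "x > 0" "Re s > 1 - real N"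
  shows "hurwitz_reg M s x = hurwitz_reg N s x"
  using assms(1)
proof (induction M rule: dec_induct)
  case (step M)
  then show ?case using hurwitz_reg_Suc_eq[of x M s] assms by simp
qed simp

text \<open>
  The regular part as an entire function of \<open>s\<close>: any step of the recursion whose half-plane contains
  \<open>s\<close> gives the same value, and \<open>2 - Re s\<close>, rounded up (and
  replaced by \<open>0\<close> if negative), is the number of such a step.
\<close>

definition hurwitz_entire :: "complex \<Rightarrow> real \<Rightarrow> complex" where
  "hurwitz_entire s x = hurwitz_reg (nat \<lceil>2 - Re s\<rceil>) s x"

lemma hurwitz_entire_eq_reg:
  assumes "x > 0" "Re s > 1 - real N"
  shows "hurwitz_entire s x = hurwitz_reg N s x"
proof -
  define K where "K = nat \<lceil>2 - Re s\<rceil>"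
  have K: "Re s > 1 - real K" unfolding K_def by linarith
  have "hurwitz_reg K s x = hurwitz_reg (max K N) s x"
    using hurwitz_reg_eq[of K "max K N" x s] K assms by simp
  also have "\<dots> = hurwitz_reg N s x"
    using hurwitz_reg_eq[of N "max K N" x s] assms by simp
  finally show ?thesis by (simp add: hurwitz_entire_def K_def)
qed

lemma holomorphic_family_hurwitz_entire: "holomorphic_family UNIV hurwitz_entire"
proof -
  have ex: "\<exists>N. 1 - real N < c" for c by (metis diff_less_eq reals_Archimedean2 add.commute)
  have "continuous_on (\<Union>N. {s. Re s > 1 - real N} \<times> {0<..}) (\<lambda>p. hurwitz_entire (fst p) (snd p))"
  proof (rule continuous_on_open_UN)
    show "continuous_on ({s. Re s > 1 - real N} \<times> {0<..}) (\<lambda>p. hurwitz_entire (fst p) (snd p))" for N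
      using holomorphic_familyD(2)[OF holomorphic_family_hurwitz_reg[of N]]
      by (rule continuous_on_cong[THEN iffD1, rotated 2]) (auto simp: hurwitz_entire_eq_reg)
  qed (auto intro!: open_Times open_halfspace_Re_gt)
  also have "(\<Union>N. {s. Re s > 1 - real N} \<times> {0<..}) = UNIV \<times> {0::real<..}"
    using ex by auto
  finally have "continuous_on (UNIV \<times> {0<..}) (\<lambda>p. hurwitz_entire (fst p) (snd p))" .
  moreover have "(\<lambda>s. hurwitz_entire s x) holomorphic_on UNIV" if "x > 0" for x
  proof -
    have "(\<lambda>s. hurwitz_entire s x) holomorphic_on (\<Union>N. {s. Re s > 1 - real N})"
    proof (rule holomorphic_on_UN_open)
      show "(\<lambda>s. hurwitz_entire s x) holomorphic_on {s. Re s > 1 - real N}" for N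
        using holomorphic_familyD(3)[OF holomorphic_family_hurwitz_reg[of N] that]
        by (rule holomorphic_cong[THEN iffD1, rotated 2]) (auto simp: hurwitz_entire_eq_reg that)
    qed (rule open_halfspace_Re_gt)
    also have "(\<Union>N. {s. Re s > 1 - real N}) = UNIV"
      using ex by auto
    finally show ?thesis .
  qed
  ultimately show ?thesis by (simp add: holomorphic_family_def split_beta)
qed

lemma hurwitz_entire_recursion:
  assumes "x > 0"
  shows "hurwitz_entire s x = integral {0..1} (\<lambda>t. of_real (1 - t) * of_real (x + t) powr (- s))
     + s * integral {0..1} (\<lambda>t. of_real (1 - t) * hurwitz_entire (s + 1) (x + t))"
proof -
  define N where "N = nat \<lceil>2 - Re s\<rceil>"
  have N: "Re s > 1 - real N" unfolding N_def by linarith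
  have "integral {0..1} (\<lambda>t. of_real (1 - t) * hurwitz_entire (s + 1) (x + t))
     = integral {0..1} (\<lambda>t. of_real (1 - t) * hurwitz_reg N (s + 1) (x + t))"
    using N assms by (intro integral_cong) (simp add: hurwitz_entire_eq_reg[where N = N])
  moreover have "hurwitz_entire s x = hurwitz_reg (Suc N) s x"
    using N assms by (intro hurwitz_entire_eq_reg) auto
  ultimately show ?thesis by simp
qed

lemma eq_off_1_if_eq_on_halfplane:
  assumes "f holomorphic_on - {1}" "g holomorphic_on - {1}"
    and "\<And>s. Re s > 1 \<Longrightarrow> f s = g s" and "s \<noteq> 1"
  shows "f s = g s"
  using continuation_off_1_eq[of f g s] continuation_off_1_eq[of g g s] assms by simp

lemma
  assumes x: "x > 0"
  shows hurwitz_entire_plus_pole_holomorphic: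
    "(\<lambda>s. of_real x powr (1 - s) / (s - 1) + hurwitz_entire s x) holomorphic_on - {1}" (is ?A)
  and hurwitz_entire_plus_pole: 
    "Re s > 1 \<Longrightarrow> of_real x powr (1 - s) / (s - 1) + hurwitz_entire s x = hurwitz_series s x"
proof -
  show ?A
    using x holomorphic_on_subset[OF holomorphic_familyD(3)[OF holomorphic_family_hurwitz_entire x]]
    by (auto intro!: holomorphic_intros)
  show "Re s > 1 \<Longrightarrow> of_real x powr (1 - s) / (s - 1) + hurwitz_entire s x = hurwitz_series s x"
    using hurwitz_entire_eq_reg[of x 0 s] x by simp
qed

lemma hurwitz_zeta_eq_entire:
  assumes "x > 0" "s \<noteq> 1"
  shows "hurwitz_zeta s x = of_real x powr (1 - s) / (s - 1) + hurwitz_entire s x"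
  unfolding hurwitz_zeta_def
  by (rule continuation_off_1_eq[OF hurwitz_entire_plus_pole_holomorphic])
     (use assms hurwitz_entire_plus_pole in \<open>auto simp: hurwitz_series_def\<close>)

lemma riemann_zeta_eq_hurwitz_zeta: "riemann_zeta s = hurwitz_zeta s 1"
proof -
  have "of_nat (Suc n) powr (- w) = (of_nat n + of_real 1 :: complex) powr (- w)" for n w
    by (simp add: add.commute)
  then show ?thesis by (simp only: riemann_zeta_def hurwitz_zeta_def)
qed

lemma hurwitz_zeta_eq_series:
  assumes "x > 0" "Re s > 1"
  shows "hurwitz_zeta s x = hurwitz_series s x"
proof -
  have "s \<noteq> 1" using assms by auto
  then show ?thesis using assms by (simp add: hurwitz_zeta_eq_entire hurwitz_entire_plus_pole)
qed

lemma holomorphic_family_cong: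
  assumes "holomorphic_family S f" "\<And>s x. s \<in> S \<Longrightarrow> x > 0 \<Longrightarrow> f s x = g s x"
  shows "holomorphic_family S g"
proof -
  have "continuous_on (S \<times> {0<..}) (\<lambda>p. g (fst p) (snd p))"
    using holomorphic_familyD(2)[OF assms(1)]
    by (rule continuous_on_cong[THEN iffD1, rotated 2]) (auto simp: assms(2))
  moreover have "(\<lambda>s. g s x) holomorphic_on S" if "x > 0" for x
    using holomorphic_familyD(3)[OF assms(1) that]
    by (rule holomorphic_cong[THEN iffD1, rotated 2]) (auto simp: assms(2) that)
  ultimately show ?thesis
    using holomorphic_familyD(1)[OF assms(1)] by (simp add: holomorphic_family_def split_beta)
qed

lemma holomorphic_family_subset:
  assumes "holomorphic_family S f" "open T" "T \<subseteq> S"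
  shows "holomorphic_family T f"
proof -
  have "continuous_on (T \<times> {0<..}) (\<lambda>(s, x). f s x)"
    by (rule continuous_on_subset[OF holomorphic_familyD(2)[OF assms(1)]]) (use assms in auto)
  then show ?thesis
    using assms holomorphic_familyD(3)[OF assms(1)]
    by (auto simp: holomorphic_family_def intro: holomorphic_on_subset)
qed

lemma holomorphic_family_hurwitz_zeta: "holomorphic_family (- {1}) hurwitz_zeta"
proof (rule holomorphic_family_cong)
  show "holomorphic_family (- {1}) (\<lambda>s x. 1 / (s - 1) * of_real x powr (1 - s) + hurwitz_entire s x)"
    by (intro holomorphic_family_add holomorphic_family_mult holomorphic_family_powr holomorphic_intros
         holomorphic_family_subset[OF holomorphic_family_hurwitz_entire]) auto
qed (simp add: hurwitz_zeta_eq_entire)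

lemma holomorphic_hurwitz_zeta: "x > 0 \<Longrightarrow> (\<lambda>s. hurwitz_zeta s x) holomorphic_on - {1}"
  by (rule holomorphic_familyD(3)[OF holomorphic_family_hurwitz_zeta])

lemma has_field_derivative_hurwitz_zeta:
  assumes "x > 0" "s \<noteq> 1"
  shows "((\<lambda>s. hurwitz_zeta s x) has_field_derivative hurwitz_zeta_deriv s x) (at s)"
  unfolding hurwitz_zeta_deriv_def
  by (rule holomorphic_derivI[OF holomorphic_hurwitz_zeta]) (use assms in auto)

lemma hurwitz_zeta_shift:
  assumes x: "x > 0" and "s \<noteq> 1"
  shows "hurwitz_zeta s x = of_real x powr (- s) + hurwitz_zeta s (x + 1)"
proof (rule eq_off_1_if_eq_on_halfplane[of "\<lambda>s. hurwitz_zeta s x" "\<lambda>s. of_real x powr (- s) + hurwitz_zeta s (x + 1)"])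
  show "(\<lambda>s. of_real x powr (- s) + hurwitz_zeta s (x + 1)) holomorphic_on - {1}"
    using x by (intro holomorphic_intros holomorphic_hurwitz_zeta) auto
  fix s assume s: "Re s > 1"
  have "(\<lambda>n. of_real (real (Suc n) + x) powr (- s)) sums hurwitz_series s (x + 1)"
    using sums_hurwitz_series[OF s, of "x + 1"] x by (simp add: add_ac)
  from sums_Suc[OF this] have "hurwitz_series s x = of_real x powr (- s) + hurwitz_series s (x + 1)"
    using sums_unique2[OF sums_hurwitz_series[OF s x]] by (simp add: add_ac)
  then show "hurwitz_zeta s x = of_real x powr (- s) + hurwitz_zeta s (x + 1)"
    using s x by (simp add: hurwitz_zeta_eq_series)
qed (use assms holomorphic_hurwitz_zeta in auto)

lemma of_real_powr_mult:
  "x > 0 \<Longrightarrow> y > 0 \<Longrightarrow> complex_of_real (x * y) powr s = of_real x powr s * of_real y powr s"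
  by (simp add: of_real_powr_exp ln_mult exp_add algebra_simps del: of_real_mult)

lemma hurwitz_zeta_duplication:
  assumes "s \<noteq> 1"
  shows "hurwitz_zeta s (1 / 2) + hurwitz_zeta s 1 = 2 powr s * hurwitz_zeta s 1"
proof (rule eq_off_1_if_eq_on_halfplane[of "\<lambda>s. hurwitz_zeta s (1 / 2) + hurwitz_zeta s 1" "\<lambda>s. 2 powr s * hurwitz_zeta s 1"])
  fix s assume s: "Re s > 1"
  define h where "h n = complex_of_real (real n + 1) powr (- s)" for n
  have "h sums hurwitz_series s 1"
    unfolding h_def by (rule sums_hurwitz_series) (use s in auto)
  then have "(\<lambda>n. sum h {n * 2..<n * 2 + 2}) sums hurwitz_series s 1"
    by (rule sums_group) simp
  moreover have "sum h {n * 2..<n * 2 + 2} = 2 powr (- s) *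
      (of_real (real n + 1 / 2) powr (- s) + of_real (real n + 1) powr (- s))" for n
  proof -
    have e: "{n * 2..<n * 2 + 2} = {2 * n, Suc (2 * n)}" by auto
    have "h (2 * n) = 2 powr (- s) * of_real (real n + 1 / 2) powr (- s)"
      using of_real_powr_mult[of 2 "real n + 1 / 2" "- s"] by (simp add: h_def algebra_simps del: of_real_add)
    moreover have "h (Suc (2 * n)) = 2 powr (- s) * of_real (real n + 1) powr (- s)"
      using of_real_powr_mult[of 2 "real n + 1" "- s"] by (simp add: h_def algebra_simps del: of_real_add)
    ultimately show ?thesis unfolding e by (simp add: ring_distribs)
  qed
  moreover have "(\<lambda>n. 2 powr (- s) * (of_real (real n + 1 / 2) powr (- s) + of_real (real n + 1) powr (- s)))
      sums (2 powr (- s) * (hurwitz_series s (1 / 2) + hurwitz_series s 1))"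
    by (intro sums_mult sums_add sums_hurwitz_series) (use s in auto)
  ultimately have "hurwitz_series s 1 = 2 powr (- s) * (hurwitz_series s (1 / 2) + hurwitz_series s 1)"
    using sums_unique2 by simp
  then have "2 powr s * hurwitz_series s 1 = hurwitz_series s (1 / 2) + hurwitz_series s 1"
    by (simp add: powr_minus field_simps)
  then show "hurwitz_zeta s (1 / 2) + hurwitz_zeta s 1 = 2 powr s * hurwitz_zeta s 1"
    using s by (simp add: hurwitz_zeta_eq_series)
qed (use assms in \<open>auto intro!: holomorphic_intros holomorphic_hurwitz_zeta\<close>)

section \<open>Derivatives in the second argument\<close>

text \<open>
  The derivative \<open>- s \<zeta>(s + 1, x)\<close> of \<open>\<zeta>(s, x)\<close> in \<open>x\<close>, written with the entire regular part
  so that it is also correct at \<open>s = 0\<close>, where the zero of \<open>s\<close> cancels the pole of \<open>\<zeta>(s + 1, x)\<close>.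
\<close>

definition hurwitz_dx :: "complex \<Rightarrow> real \<Rightarrow> complex" where
  "hurwitz_dx s x = - (of_real x powr (- s) + s * hurwitz_entire (s + 1) x)"

lemma hurwitz_dx_eq:
  assumes "x > 0" "s \<noteq> 0"
  shows "hurwitz_dx s x = - s * hurwitz_zeta (s + 1) x"
  using assms by (simp add: hurwitz_dx_def hurwitz_zeta_eq_entire algebra_simps)

lemma holomorphic_family_hurwitz_dx: "holomorphic_family UNIV hurwitz_dx"
proof (rule holomorphic_family_cong)
  show "holomorphic_family UNIV (\<lambda>s x. (- 1) * (of_real x powr (- s) + s * hurwitz_entire (s + 1) x))"
    by (intro holomorphic_family_add holomorphic_family_mult holomorphic_family_powr holomorphic_intros
          holomorphic_family_shift[OF holomorphic_family_hurwitz_entire]) auto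
qed (simp add: hurwitz_dx_def)

lemma has_integral_powr:
  fixes a b c :: real and s :: complex
  assumes "a \<le> b" "c + a > 0"
  shows "((\<lambda>t. s * of_real (c + t) powr (s - 1)) has_integral
     (of_real (c + b) powr s - of_real (c + a) powr s)) {a..b}"
proof (rule fundamental_theorem_of_calculus)
  fix t assume t: "t \<in> {a..b}"
  have np: "of_real c + complex_of_real t \<notin> \<real>\<^sub>\<le>\<^sub>0"
    using assms t by (auto simp flip: of_real_add)
  have "((\<lambda>w. complex_of_real c + w) has_field_derivative 1) (at (of_real t))"
    by (auto intro!: derivative_eq_intros)
  from DERIV_chain2[OF has_field_derivative_powr[OF np] this, of s]
  have "((\<lambda>w. (of_real c + w) powr s) has_field_derivative s * (of_real c + of_real t) powr (s - 1)) (at (of_real t))"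
    by simp
  then show "((\<lambda>t. of_real (c + t) powr s) has_vector_derivative s * of_real (c + t) powr (s - 1)) (at t within {a..b})"
    by (auto dest: has_vector_derivative_real_field)
qed fact

lemma hurwitz_series_diff:
  assumes s: "Re s > 1" and x: "0 < x" and y: "x \<le> y"
  shows "hurwitz_series s y - hurwitz_series s x = integral {x..y} (\<lambda>t. - s * hurwitz_series (s + 1) t)"
proof -
  define f where "f n t = - s * of_real (real n + t) powr (- s - 1)" for n t
  have f_int: "((\<lambda>t. \<Sum>n<N. f n t) has_integral
      (\<Sum>n<N. of_real (real n + y) powr (- s) - of_real (real n + x) powr (- s))) {x..y}" for N
    unfolding f_def by (intro has_integral_sum has_integral_powr) (use x y in auto)
  have "uniform_limit {x..y} (\<lambda>N t. \<Sum>n<N. of_real (real n + snd (s + 1, t)) powr (- fst (s + 1, t)))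
     (\<lambda>t. hurwitz_series (fst (s + 1, t)) (snd (s + 1, t))) sequentially"
    by (rule uniform_limit_compose'[OF uniform_limit_hurwitz_series[of 1]]) (use s x y in auto)
  then have "uniform_limit {x..y} (\<lambda>N t. - s * (\<Sum>n<N. of_real (real n + t) powr (- s - 1)))
     (\<lambda>t. - s * hurwitz_series (s + 1) t) sequentially"
    by (intro bounded_linear.uniform_limit[OF bounded_linear_mult_right]) simp
  then have "uniform_limit {x..y} (\<lambda>N t. \<Sum>n<N. f n t) (\<lambda>t. - s * hurwitz_series (s + 1) t) sequentially"
    by (simp add: f_def sum_distrib_left)
  moreover have "continuous_on {x..y} (\<lambda>t. \<Sum>n<N. f n t)" for N
    unfolding f_def using x by (intro continuous_intros continuous_on_of_real_powr) auto
  ultimately obtain I J where IJ: "\<And>N. ((\<lambda>t. \<Sum>n<N. f n t) has_integral I N) {x..y}"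
     "((\<lambda>t. - s * hurwitz_series (s + 1) t) has_integral J) {x..y}" "I \<longlonglongrightarrow> J"
    using uniform_limit_integral[where a = x and b = y and f = "\<lambda>N t. \<Sum>n<N. f n t"
       and g = "\<lambda>t. - s * hurwitz_series (s + 1) t" and F = sequentially] by auto
  have I: "I = (\<lambda>N. \<Sum>n<N. of_real (real n + y) powr (- s) - of_real (real n + x) powr (- s))"
    using has_integral_unique[OF IJ(1) f_int] by (rule ext)
  have "I \<longlonglongrightarrow> hurwitz_series s y - hurwitz_series s x"
    unfolding I using sums_diff[OF sums_hurwitz_series[OF s, of y] sums_hurwitz_series[OF s, of x]] x y
    by (simp add: sums_def)
  then have "J = hurwitz_series s y - hurwitz_series s x"
    using IJ(3) LIMSEQ_unique by blast
  then show ?thesis using integral_unique[OF IJ(2)] by simp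
qed

lemma hurwitz_zeta_diff:
  assumes x: "0 < x" "x \<le> y" and "s \<noteq> 1"
  shows "hurwitz_zeta s y - hurwitz_zeta s x = integral {x..y} (hurwitz_dx s)"
proof (rule eq_off_1_if_eq_on_halfplane[where f = "\<lambda>s. hurwitz_zeta s y - hurwitz_zeta s x"])
  have "(\<lambda>s. integral {x..y} (hurwitz_dx s)) holomorphic_on UNIV"
  proof (rule holomorphic_on_integral_param)
    show "continuous_on (UNIV \<times> {x..y}) (\<lambda>(s, t). hurwitz_dx s t)"
      by (rule continuous_on_subset[OF holomorphic_familyD(2)[OF holomorphic_family_hurwitz_dx]])
         (use x in auto)
    show "(\<lambda>s. hurwitz_dx s t) holomorphic_on UNIV" if "t \<in> {x..y}" for t
      by (rule holomorphic_familyD(3)[OF holomorphic_family_hurwitz_dx]) (use x that in auto)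
  qed auto
  then show "(\<lambda>s. integral {x..y} (hurwitz_dx s)) holomorphic_on - {1}"
    by (rule holomorphic_on_subset) auto
  fix s assume s: "Re s > 1"
  then have "s \<noteq> 0" by auto
  then have "integral {x..y} (hurwitz_dx s) = integral {x..y} (\<lambda>t. - s * hurwitz_series (s + 1) t)"
    using x s by (intro integral_cong) (auto simp: hurwitz_dx_eq hurwitz_zeta_eq_series)
  then show "hurwitz_zeta s y - hurwitz_zeta s x = integral {x..y} (hurwitz_dx s)"
    using hurwitz_series_diff[OF s x] s x by (simp add: hurwitz_zeta_eq_series)
qed (use assms in \<open>auto intro!: holomorphic_intros holomorphic_hurwitz_zeta\<close>)

text \<open>
  The second derivative of \<open>\<zeta>(s, x)\<close> in \<open>x\<close>, in integrated form; \<open>s = 0\<close> is included because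
  \<open>hurwitz_dx 0\<close> is constant.
\<close>

lemma hurwitz_dx_diff:
  assumes x: "0 < x" "x \<le> y"
  shows "hurwitz_dx s y - hurwitz_dx s x = integral {x..y} (\<lambda>t. - s * hurwitz_dx (s + 1) t)"
proof (cases "s = 0")
  case False
  then have "hurwitz_dx s y - hurwitz_dx s x = - s * (hurwitz_zeta (s + 1) y - hurwitz_zeta (s + 1) x)"
    using x by (simp add: hurwitz_dx_eq algebra_simps)
  then show ?thesis using False x by (simp add: hurwitz_zeta_diff)
qed (use x in \<open>simp add: hurwitz_dx_def\<close>)

text \<open>
  If \<open>g\<close> is the derivative of \<open>f\<close> in \<open>x\<close>, then the derivative of \<open>g\<close> in \<open>s\<close> is the mixed derivative
  of \<open>f\<close>, in either order: the integrated relation is differentiated in \<open>s\<close> under the integral sign.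
\<close>

lemma has_vector_derivative_deriv_param:
  assumes g: "holomorphic_family S g"
    and f: "\<And>x. x > 0 \<Longrightarrow> (\<lambda>s. f s x) holomorphic_on S"
    and diff: "\<And>s x y. s \<in> S \<Longrightarrow> 0 < x \<Longrightarrow> x \<le> y \<Longrightarrow> f s y - f s x = integral {x..y} (g s)"
    and s: "s \<in> S" and x: "x > 0"
  shows "((\<lambda>x. deriv (\<lambda>s. f s x) s) has_vector_derivative deriv (\<lambda>s. g s x) s) (at x)"
proof -
  note S = holomorphic_familyD(1)[OF g]
  have eq: "deriv (\<lambda>s. f s v) s - deriv (\<lambda>s. f s u) s = integral {u..v} (\<lambda>t. deriv (\<lambda>s. g s t) s)"
    if uv: "0 < u" "u \<le> v" for u v
  proof -
    have "((\<lambda>s. integral {u..v} (g s)) has_field_derivative integral {u..v} (\<lambda>t. deriv (\<lambda>s. g s t) s)) (at s)"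
    proof (rule has_field_derivative_integral_param[OF S _ _ s])
      show "continuous_on (S \<times> {u..v}) (\<lambda>(s, t). g s t)"
        by (rule continuous_on_subset[OF holomorphic_familyD(2)[OF g]]) (use uv in auto)
    qed (use holomorphic_familyD(3)[OF g] uv in auto)
    then have "((\<lambda>s. f s v - f s u) has_field_derivative integral {u..v} (\<lambda>t. deriv (\<lambda>s. g s t) s)) (at s)"
      by (rule has_field_derivative_transform_within_open[OF _ S s]) (simp add: diff uv)
    moreover have "((\<lambda>s. f s v - f s u) has_field_derivative deriv (\<lambda>s. f s v) s - deriv (\<lambda>s. f s u) s) (at s)"
      using uv by (intro DERIV_diff holomorphic_derivI[OF f S s]) auto
    ultimately show ?thesis using DERIV_unique by blast
  qed
  have "continuous_on {x/2..2*x} (\<lambda>t. deriv (\<lambda>s. g s t) s)"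
    by (rule holomorphic_family_deriv_compose[OF g]) (use x s in \<open>auto intro!: continuous_intros\<close>)
  then have "((\<lambda>v. integral {x/2..v} (\<lambda>t. deriv (\<lambda>s. g s t) s)) has_vector_derivative
      deriv (\<lambda>s. g s x) s) (at x within {x/2..2*x})"
    by (rule integral_has_vector_derivative) (use x in auto)
  then have "((\<lambda>v. integral {x/2..v} (\<lambda>t. deriv (\<lambda>s. g s t) s) + deriv (\<lambda>s. f s (x/2)) s) has_vector_derivative
      deriv (\<lambda>s. g s x) s) (at x within {x/2..2*x})"
    by (auto intro!: derivative_eq_intros)
  then have "((\<lambda>x. deriv (\<lambda>s. f s x) s) has_vector_derivative deriv (\<lambda>s. g s x) s) (at x within {x/2..2*x})"
    by (rule has_vector_derivative_transform[rotated 2])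
       (use x eq in \<open>auto simp: algebra_simps\<close>)
  then show ?thesis using x by (simp add: at_within_Icc_at)
qed

lemma has_vector_derivative_hurwitz_zeta_deriv:
  assumes x: "x > 0" and s: "s \<noteq> 0" "s \<noteq> 1"
  shows "(hurwitz_zeta_deriv s has_vector_derivative
           - hurwitz_zeta (s + 1) x - s * hurwitz_zeta_deriv (s + 1) x) (at x)"
proof -
  have "((\<lambda>s. hurwitz_zeta (s + 1) x) has_field_derivative hurwitz_zeta_deriv (s + 1) x) (at s)"
    using has_field_derivative_hurwitz_zeta[OF x, of "s + 1"] s by (simp add: DERIV_shift)
  then have "((\<lambda>s. - s * hurwitz_zeta (s + 1) x) has_field_derivative
      - hurwitz_zeta (s + 1) x - s * hurwitz_zeta_deriv (s + 1) x) (at s)"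
    by (auto intro!: derivative_eq_intros)
  then have "((\<lambda>s. hurwitz_dx s x) has_field_derivative
      - hurwitz_zeta (s + 1) x - s * hurwitz_zeta_deriv (s + 1) x) (at s)"
    by (rule has_field_derivative_transform_within_open[of _ _ _ "- {0}"])
       (use s x in \<open>auto simp: hurwitz_dx_eq\<close>)
  then have "deriv (\<lambda>s. hurwitz_dx s x) s = - hurwitz_zeta (s + 1) x - s * hurwitz_zeta_deriv (s + 1) x"
    by (rule DERIV_imp_deriv)
  moreover have "((\<lambda>x. deriv (\<lambda>s. hurwitz_zeta s x) s) has_vector_derivative deriv (\<lambda>s. hurwitz_dx s x) s) (at x)"
    by (rule has_vector_derivative_deriv_param[where S = "- {1}"])
       (use s x in \<open>auto intro!: holomorphic_family_subset[OF holomorphic_family_hurwitz_dx] holomorphic_hurwitz_zeta hurwitz_zeta_diff\<close>)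
  ultimately show ?thesis by (simp add: hurwitz_zeta_deriv_def[abs_def])
qed

lemma has_vector_derivative_hurwitz_zeta_deriv_0:
  assumes x: "x > 0"
  shows "(hurwitz_zeta_deriv 0 has_vector_derivative deriv (\<lambda>s. hurwitz_dx s x) 0) (at x)"
  unfolding hurwitz_zeta_deriv_def[abs_def]
  by (rule has_vector_derivative_deriv_param[where S = "- {1}"])
     (use x in \<open>auto intro!: holomorphic_family_subset[OF holomorphic_family_hurwitz_dx] holomorphic_hurwitz_zeta hurwitz_zeta_diff\<close>)

lemma has_vector_derivative_deriv_hurwitz_dx_0:
  assumes x: "x > 0"
  shows "((\<lambda>x. deriv (\<lambda>s. hurwitz_dx s x) 0) has_vector_derivative hurwitz_zeta 2 x) (at x)"
proof -
  have fam: "holomorphic_family UNIV (\<lambda>s x. - s * hurwitz_dx (s + 1) x)"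
    by (intro holomorphic_family_mult holomorphic_intros holomorphic_family_shift[OF holomorphic_family_hurwitz_dx]) auto
  have "(\<lambda>s. hurwitz_dx s x) holomorphic_on UNIV"
    using holomorphic_familyD(3)[OF holomorphic_family_hurwitz_dx x] .
  then have "((\<lambda>s. hurwitz_dx s x) has_field_derivative deriv (\<lambda>s. hurwitz_dx s x) 1) (at (0 + 1))"
    by (auto intro: holomorphic_derivI)
  then have "((\<lambda>s. hurwitz_dx (s + 1) x) has_field_derivative deriv (\<lambda>s. hurwitz_dx s x) 1) (at 0)"
    by (simp only: DERIV_shift)
  then have "((\<lambda>s. - s * hurwitz_dx (s + 1) x) has_field_derivative - hurwitz_dx 1 x) (at 0)"
    by (auto intro!: derivative_eq_intros)
  then have "deriv (\<lambda>s. - s * hurwitz_dx (s + 1) x) 0 = hurwitz_zeta 2 x"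
    using x by (simp add: DERIV_imp_deriv hurwitz_dx_eq)
  moreover have "((\<lambda>x. deriv (\<lambda>s. hurwitz_dx s x) 0) has_vector_derivative
      deriv (\<lambda>s. - s * hurwitz_dx (s + 1) x) 0) (at x)"
    by (rule has_vector_derivative_deriv_param[OF fam])
       (use x hurwitz_dx_diff holomorphic_familyD(3)[OF holomorphic_family_hurwitz_dx] in auto)
  ultimately show ?thesis by simp
qed

section \<open>Special values\<close>

lemma integral_cubic:
  fixes a b c d :: complex
  shows "integral {0..1} (\<lambda>t. a + b * of_real t + c * of_real t ^ 2 + d * of_real t ^ 3) = a + b / 2 + c / 3 + d / 4"
proof -
  define F where "F t = a * of_real t + b * of_real t ^ 2 / 2 + c * of_real t ^ 3 / 3 + d * of_real t ^ 4 / 4" for t :: real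
  have "((\<lambda>t. a + b * of_real t + c * of_real t ^ 2 + d * of_real t ^ 3) has_integral (F 1 - F 0)) {0..1}"
  proof (rule fundamental_theorem_of_calculus)
    fix t :: real
    have "((\<lambda>w. a * w + b * w ^ 2 / 2 + c * w ^ 3 / 3 + d * w ^ 4 / 4) has_field_derivative
       a + b * of_real t + c * of_real t ^ 2 + d * of_real t ^ 3) (at (of_real t))"
      by (auto intro!: derivative_eq_intros)
    from has_vector_derivative_real_field[OF this]
    show "(F has_vector_derivative a + b * of_real t + c * of_real t ^ 2 + d * of_real t ^ 3) (at t within {0..1})"
      by (simp add: F_def[abs_def])
  qed simp
  from integral_unique[OF this] show ?thesis by (simp add: F_def)
qed

lemma hurwitz_entire_0:
  assumes "x > 0" shows "hurwitz_entire 0 x = 1 / 2"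
proof -
  have "integral {0..1} (\<lambda>t. of_real (1 - t) * of_real (x + t) powr (- 0))
     = integral {0..1} (\<lambda>t. 1 + (- 1) * complex_of_real t + 0 * of_real t ^ 2 + 0 * of_real t ^ 3)"
    using assms by (intro integral_cong) (auto simp: add_pos_nonneg simp flip: of_real_add)
  then show ?thesis
    using hurwitz_entire_recursion[OF assms, of 0] by (simp only: integral_cubic) simp
qed

lemma hurwitz_entire_neg1:
  assumes "x > 0" shows "hurwitz_entire (- 1) x = of_real x / 2 - 1 / 12"
proof -
  have "integral {0..1} (\<lambda>t. of_real (1 - t) * of_real (x + t) powr (- (- 1)))
     = integral {0..1} (\<lambda>t. of_real x + (1 - of_real x) * complex_of_real t + (- 1) * of_real t ^ 2 + 0 * of_real t ^ 3)"
    using assms by (intro integral_cong) (auto simp: algebra_simps power2_eq_square)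
  moreover have "integral {0..1} (\<lambda>t. of_real (1 - t) * hurwitz_entire (- 1 + 1) (x + t))
     = integral {0..1} (\<lambda>t. 1 / 2 + (- 1 / 2) * complex_of_real t + 0 * of_real t ^ 2 + 0 * of_real t ^ 3)"
    using assms by (intro integral_cong) (auto simp: hurwitz_entire_0 field_simps)
  ultimately show ?thesis
    using hurwitz_entire_recursion[OF assms, of "- 1"]
    by (simp only: integral_cubic) (simp add: field_simps)
qed

lemma hurwitz_entire_neg2_1: "hurwitz_entire (- 2) 1 = 1 / 3"
proof -
  have "integral {0..1} (\<lambda>t. of_real (1 - t) * of_real (1 + t) powr (- (- 2)))
     = integral {0..1} (\<lambda>t. 1 + 1 * complex_of_real t + (- 1) * of_real t ^ 2 + (- 1) * of_real t ^ 3)"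
  proof (rule integral_cong)
    fix t :: real assume "t \<in> {0..1}"
    then have "complex_of_real (1 + t) powr of_nat 2 = of_real (1 + t) ^ 2"
      by (intro powr_nat') auto
    then show "of_real (1 - t) * of_real (1 + t) powr (- (- 2)) =
        1 + 1 * complex_of_real t + (- 1) * of_real t ^ 2 + (- 1) * of_real t ^ 3"
      by (simp add: algebra_simps power2_eq_square power3_eq_cube)
  qed
  moreover have "integral {0..1} (\<lambda>t. of_real (1 - t) * hurwitz_entire (- 2 + 1) (1 + t))
     = integral {0..1} (\<lambda>t. 5 / 12 + (1 / 12) * complex_of_real t + (- 1 / 2) * of_real t ^ 2 + 0 * of_real t ^ 3)"
    by (intro integral_cong) (auto simp: hurwitz_entire_neg1 field_simps power2_eq_square)
  ultimately show ?thesis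
    using hurwitz_entire_recursion[of 1 "- 2"]
    by (simp only: integral_cubic) simp
qed

lemma hurwitz_zeta_0: "x > 0 \<Longrightarrow> hurwitz_zeta 0 x = 1 / 2 - of_real x"
  by (simp add: hurwitz_zeta_eq_entire hurwitz_entire_0)

lemma hurwitz_zeta_neg1:
  assumes "x > 0"
  shows "hurwitz_zeta (- 1) x = - (of_real x ^ 2) / 2 + of_real x / 2 - 1 / 12"
  using powr_nat'[of "complex_of_real x" 2] assms by (simp add: hurwitz_zeta_eq_entire hurwitz_entire_neg1)

lemma hurwitz_zeta_neg2_1: "hurwitz_zeta (- 2) 1 = 0"
  by (simp add: hurwitz_zeta_eq_entire hurwitz_entire_neg2_1)

lemma hurwitz_zeta_deriv_shift:
  assumes "x > 0" "s \<noteq> 1"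
  shows "hurwitz_zeta_deriv s x = - of_real (ln x) * of_real x powr (- s) + hurwitz_zeta_deriv s (x + 1)"
proof -
  have "((\<lambda>s. of_real x powr (- s)) has_field_derivative - of_real (ln x) * of_real x powr (- s)) (at s)"
    unfolding of_real_powr_exp[OF assms(1)] by (auto intro!: derivative_eq_intros)
  then have "((\<lambda>s. of_real x powr (- s) + hurwitz_zeta s (x + 1)) has_field_derivative
     - of_real (ln x) * of_real x powr (- s) + hurwitz_zeta_deriv s (x + 1)) (at s)"
    using assms by (intro DERIV_add has_field_derivative_hurwitz_zeta) auto
  then have "((\<lambda>s. hurwitz_zeta s x) has_field_derivative
     - of_real (ln x) * of_real x powr (- s) + hurwitz_zeta_deriv s (x + 1)) (at s)"
    by (rule has_field_derivative_transform_within_open[of _ _ _ "- {1}"])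
       (use assms hurwitz_zeta_shift[OF assms(1)] in auto)
  then show ?thesis unfolding hurwitz_zeta_deriv_def[of s x] by (rule DERIV_imp_deriv)
qed

lemma hurwitz_zeta_deriv_duplication:
  assumes "s \<noteq> 1"
  shows "hurwitz_zeta_deriv s (1 / 2) + hurwitz_zeta_deriv s 1 =
     of_real (ln 2) * 2 powr s * hurwitz_zeta s 1 + 2 powr s * hurwitz_zeta_deriv s 1"
proof -
  have "((\<lambda>s. 2 powr s) has_field_derivative of_real (ln 2) * 2 powr s) (at s)"
  proof -
    have "2 powr w = exp (w * of_real (ln 2))" for w :: complex
      using of_real_powr_exp[of 2 w] by simp
    then show ?thesis by (simp only:) (auto intro!: derivative_eq_intros)
  qed
  from DERIV_mult[OF this has_field_derivative_hurwitz_zeta[of 1 s]] assms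
  have "((\<lambda>s. 2 powr s * hurwitz_zeta s 1) has_field_derivative
      of_real (ln 2) * 2 powr s * hurwitz_zeta s 1 + 2 powr s * hurwitz_zeta_deriv s 1) (at s)"
    by (simp add: mult_ac)
  then have "((\<lambda>s. hurwitz_zeta s (1 / 2) + hurwitz_zeta s 1) has_field_derivative
      of_real (ln 2) * 2 powr s * hurwitz_zeta s 1 + 2 powr s * hurwitz_zeta_deriv s 1) (at s)"
    by (rule has_field_derivative_transform_within_open[of _ _ _ "- {1}"])
       (use assms hurwitz_zeta_duplication in auto)
  moreover have "((\<lambda>s. hurwitz_zeta s (1 / 2) + hurwitz_zeta s 1) has_field_derivative
      hurwitz_zeta_deriv s (1 / 2) + hurwitz_zeta_deriv s 1) (at s)"
    using assms by (intro DERIV_add has_field_derivative_hurwitz_zeta) auto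
  ultimately show ?thesis using DERIV_unique by blast
qed

section \<open>The derivative at zero and the reflected combinations\<close>

lemma has_vector_derivative_zero_imp_constant:
  fixes f :: "real \<Rightarrow> 'a::real_normed_vector"
  assumes "convex S" "\<And>x. x \<in> S \<Longrightarrow> (f has_vector_derivative 0) (at x)"
  shows "\<exists>c. \<forall>x\<in>S. f x = c"
proof (rule has_derivative_zero_constant[OF assms(1)])
  show "(f has_derivative (\<lambda>h. 0)) (at x within S)" if "x \<in> S" for x
    using has_vector_derivative_at_within[OF assms(2)[OF that], of S] by (simp add: has_vector_derivative_def)
qed

lemma hurwitz_zeta_of_nat_sums:
  assumes "x > 0" "n \<ge> 2"
  shows "(\<lambda>k. complex_of_real (inverse ((x + real k) ^ n))) sums hurwitz_zeta (of_nat n) x"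
proof -
  have "(\<lambda>k. complex_of_real (real k + x) powr (- of_nat n)) sums hurwitz_zeta (of_nat n) x"
    using sums_hurwitz_series[of "of_nat n" x] assms by (simp add: hurwitz_zeta_eq_series)
  moreover have "complex_of_real (real k + x) powr (- of_nat n) = complex_of_real (inverse ((x + real k) ^ n))" for k
    using assms powr_nat'[of "complex_of_real (real k + x)" n]
    by (simp add: powr_minus add_ac)
  ultimately show ?thesis by simp
qed

lemma hurwitz_zeta_2:
  assumes "x > 0"
  shows "hurwitz_zeta 2 x = of_real (Polygamma 1 x)"
proof -
  have "(\<lambda>k. inverse ((x + real k) ^ 2)) sums Polygamma 1 x"
    using Polygamma_LIMSEQ[of x 1] assms by (simp add: numeral_2_eq_2)
  then have "(\<lambda>k. complex_of_real (inverse ((x + real k) ^ 2))) sums of_real (Polygamma 1 x)"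
    by (rule sums_of_real)
  then show ?thesis
    using sums_unique2 hurwitz_zeta_of_nat_sums[of x 2] assms by fastforce
qed

lemma hurwitz_zeta_deriv_0_half: "hurwitz_zeta_deriv 0 (1 / 2) = - of_real (ln 2) / 2"
  using hurwitz_zeta_deriv_duplication[of 0] by (simp add: hurwitz_zeta_0)

text \<open>
  Lerch's formula. Both sides have the second derivative \<open>\<zeta>(2, x) = Polygamma 1 x\<close> in \<open>x\<close>, so they
  differ by an affine function. Its slope is \<open>0\<close> because both sides grow by \<open>ln x\<close> from \<open>x\<close> to
  \<open>x + 1\<close>, and its value at \<open>1 / 2\<close> is known from the duplication formula.
\<close>

lemma hurwitz_zeta_deriv_0:
  assumes "x > 0"
  shows "hurwitz_zeta_deriv 0 x = of_real (ln_Gamma x - ln (2 * pi) / 2)"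
proof -
  define \<psi> where "\<psi> x = deriv (\<lambda>s. hurwitz_dx s x) 0" for x
  have dGamma: "((\<lambda>x. complex_of_real (ln_Gamma x)) has_vector_derivative of_real (Digamma x)) (at x)" if "x > 0" for x
    using has_field_derivative_ln_Gamma_real[OF that]
    by (intro has_vector_derivative_of_real) (simp add: has_real_derivative_iff_has_vector_derivative)
  have "(Digamma has_field_derivative Polygamma 1 x) (at x)" if "x > 0" for x :: real
  proof -
    have "x \<notin> \<int>\<^sub>\<le>\<^sub>0" using that by (auto elim!: nonpos_Ints_cases)
    from has_field_derivative_Polygamma[OF this, of 0] show ?thesis by simp
  qed
  then have dDigamma: "((\<lambda>x. complex_of_real (Digamma x)) has_vector_derivative of_real (Polygamma 1 x)) (at x)" if "x > 0" for x
    using that by (intro has_vector_derivative_of_real) (simp add: has_real_derivative_iff_has_vector_derivative)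
  have "\<exists>c. \<forall>x\<in>{0<..}. \<psi> x - of_real (Digamma x) = c"
  proof (rule has_vector_derivative_zero_imp_constant)
    show "((\<lambda>x. \<psi> x - of_real (Digamma x)) has_vector_derivative 0) (at x)" if "x \<in> {0<..}" for x
      using has_vector_derivative_diff[OF has_vector_derivative_deriv_hurwitz_dx_0 dDigamma, of x] that
      by (simp add: \<psi>_def hurwitz_zeta_2)
  qed simp
  then obtain c where c: "\<And>x. x > 0 \<Longrightarrow> \<psi> x - of_real (Digamma x) = c" by auto
  have "\<exists>a. \<forall>x\<in>{0<..}. hurwitz_zeta_deriv 0 x - of_real (ln_Gamma x) - c * of_real x = a"
  proof (rule has_vector_derivative_zero_imp_constant)
    show "((\<lambda>x. hurwitz_zeta_deriv 0 x - of_real (ln_Gamma x) - c * of_real x) has_vector_derivative 0) (at x)"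
      if "x \<in> {0<..}" for x
    proof -
      have "((\<lambda>x. c * of_real x) has_vector_derivative c) (at x)"
        by (auto intro!: derivative_eq_intros)
      from has_vector_derivative_diff[OF has_vector_derivative_diff[OF has_vector_derivative_hurwitz_zeta_deriv_0 dGamma] this]
      show ?thesis using that c[of x] by (simp add: \<psi>_def)
    qed
  qed simp
  then obtain a where a: "\<And>x. x > 0 \<Longrightarrow> hurwitz_zeta_deriv 0 x - of_real (ln_Gamma x) - c * of_real x = a" by auto
  have "hurwitz_zeta_deriv 0 1 = hurwitz_zeta_deriv 0 2"
    using hurwitz_zeta_deriv_shift[of 1 0] by simp
  moreover have "Gamma (2::real) = 1"
    using Gamma_fact[of 1, where 'a = real] by simp
  ultimately have "c * 2 = c"
    using a[of 1] a[of 2] by (simp add: ln_Gamma_real_pos diff_eq_eq eq_diff_eq algebra_simps)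
  then have "c = 0" by simp
  have lnG: "ln_Gamma (1 / 2 :: real) = ln pi / 2"
    by (simp add: ln_Gamma_real_pos Gamma_one_half_real ln_sqrt)
  have "a = - of_real (ln 2) / 2 - of_real (ln pi / 2)"
    using a[of "1 / 2"] unfolding lnG hurwitz_zeta_deriv_0_half \<open>c = 0\<close> by simp
  then have "a = - of_real (ln (2 * pi) / 2)"
    by (simp add: ln_mult_pos add_divide_distrib)
  then show ?thesis
    using a[OF assms] \<open>c = 0\<close> by (simp add: algebra_simps)
qed

lemma Gamma_reflection_real:
  assumes "0 < x" "x < 1"
  shows "Gamma x * Gamma (1 - x) = pi / sin (pi * x)"
proof -
  have "complex_of_real (Gamma x * Gamma (1 - x)) = of_real (pi / sin (pi * x))"
  proof -
    have "1 - complex_of_real x = of_real (1 - x)" by simp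
    then show ?thesis
      using Gamma_reflection_complex[of "of_real x"]
      by (simp only: Gamma_complex_of_real sin_of_real of_real_mult [symmetric] of_real_divide [symmetric])
  qed
  then show ?thesis by (simp only: of_real_eq_iff)
qed

lemma hurwitz_zeta_deriv_0_reflection:
  assumes x: "0 < x" "x < 1"
  shows "hurwitz_zeta_deriv 0 x + hurwitz_zeta_deriv 0 (1 - x) = - of_real (ln (2 * sin (pi * x)))"
proof -
  have s: "sin (pi * x) > 0"
    using x by (intro sin_gt_zero) auto
  have "ln_Gamma x + ln_Gamma (1 - x) = ln (Gamma x * Gamma (1 - x))"
    using x Gamma_real_pos[of x] Gamma_real_pos[of "1 - x"] by (simp add: ln_Gamma_real_pos ln_mult_pos)
  also have "\<dots> = ln (2 * pi) - ln (2 * sin (pi * x))"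
    using x s by (simp add: Gamma_reflection_real ln_div ln_mult)
  finally have "ln_Gamma x - ln (2 * pi) / 2 + (ln_Gamma (1 - x) - ln (2 * pi) / 2) = - ln (2 * sin (pi * x))"
    by (simp add: field_simps)
  then show ?thesis
    using x by (simp only: hurwitz_zeta_deriv_0 diff_gt_0_iff_gt flip: of_real_add of_real_minus)
qed

lemma has_vector_derivative_reflect:
  assumes "(f has_vector_derivative f') (at (1 - x))"
  shows "((\<lambda>x. f (1 - x)) has_vector_derivative - f') (at x)"
proof -
  have "((\<lambda>x::real. 1 - x) has_vector_derivative - 1) (at x)"
    by (auto intro!: derivative_eq_intros)
  from vector_diff_chain_at[OF this assms] show ?thesis by (simp add: o_def)
qed

text \<open>
  The combinations of \<open>\<zeta>'(-2, \<cdot>)\<close> and \<open>\<zeta>'(-1, \<cdot>)\<close> that are even and odd under \<open>x \<mapsto> 1 - x\<close>.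
\<close>

definition hurwitz_deriv_even :: "real \<Rightarrow> complex" where
  "hurwitz_deriv_even x = hurwitz_zeta_deriv (- 2) x + hurwitz_zeta_deriv (- 2) (1 - x)"

definition hurwitz_deriv_odd :: "real \<Rightarrow> complex" where
  "hurwitz_deriv_odd x = hurwitz_zeta_deriv (- 1) x - hurwitz_zeta_deriv (- 1) (1 - x)"

lemma has_vector_derivative_hurwitz_deriv_odd:
  assumes x: "0 < x" "x < 1"
  shows "(hurwitz_deriv_odd has_vector_derivative
           - of_real (ln (2 * sin (pi * x)))) (at x)"
proof -
  have D: "(hurwitz_zeta_deriv (- 1) has_vector_derivative
           - hurwitz_zeta 0 y + hurwitz_zeta_deriv 0 y) (at y)" if "y > 0" for y
    using has_vector_derivative_hurwitz_zeta_deriv[OF that, of "- 1"] by simp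
  have "((\<lambda>x. hurwitz_zeta_deriv (- 1) x - hurwitz_zeta_deriv (- 1) (1 - x)) has_vector_derivative
      (- hurwitz_zeta 0 x + hurwitz_zeta_deriv 0 x) - - (- hurwitz_zeta 0 (1 - x) + hurwitz_zeta_deriv 0 (1 - x))) (at x)"
    using x by (intro has_vector_derivative_diff has_vector_derivative_reflect D) auto
  also have "(- hurwitz_zeta 0 x + hurwitz_zeta_deriv 0 x) - - (- hurwitz_zeta 0 (1 - x) + hurwitz_zeta_deriv 0 (1 - x))
      = hurwitz_zeta_deriv 0 x + hurwitz_zeta_deriv 0 (1 - x)"
    using x by (simp add: hurwitz_zeta_0)
  finally show ?thesis 
    using x by (simp only: hurwitz_zeta_deriv_0_reflection hurwitz_deriv_odd_def[abs_def])
qed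

lemma has_vector_derivative_hurwitz_deriv_even:
  assumes x: "0 < x" "x < 1"
  shows "(hurwitz_deriv_even has_vector_derivative
           2 * hurwitz_deriv_odd x) (at x)"
proof -
  have D: "(hurwitz_zeta_deriv (- 2) has_vector_derivative
           - hurwitz_zeta (- 1) y + 2 * hurwitz_zeta_deriv (- 1) y) (at y)" if "y > 0" for y
    using has_vector_derivative_hurwitz_zeta_deriv[OF that, of "- 2"] by simp
  have "((\<lambda>x. hurwitz_zeta_deriv (- 2) x + hurwitz_zeta_deriv (- 2) (1 - x)) has_vector_derivative
      (- hurwitz_zeta (- 1) x + 2 * hurwitz_zeta_deriv (- 1) x)
      + - (- hurwitz_zeta (- 1) (1 - x) + 2 * hurwitz_zeta_deriv (- 1) (1 - x))) (at x)"
    using x by (intro has_vector_derivative_add has_vector_derivative_reflect D) auto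
  also have "(- hurwitz_zeta (- 1) x + 2 * hurwitz_zeta_deriv (- 1) x)
      + - (- hurwitz_zeta (- 1) (1 - x) + 2 * hurwitz_zeta_deriv (- 1) (1 - x))
      = 2 * (hurwitz_zeta_deriv (- 1) x - hurwitz_zeta_deriv (- 1) (1 - x))"
    using x by (simp add: hurwitz_zeta_neg1 field_simps power2_eq_square)
  finally show ?thesis by (simp only: hurwitz_deriv_even_def[abs_def] hurwitz_deriv_odd_def)
qed

section \<open>A Fourier series for the log-sine function\<close>

text \<open>
  The series \<open>\<Sum>n\<ge>1. r^n cos(2\<pi>nx) / n^3\<close>. The index \<open>n = 0\<close> contributes nothing, because division
  by \<open>0\<close> yields \<open>0\<close>.
\<close>

definition cos_cube_series :: "real \<Rightarrow> real \<Rightarrow> real" where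
  "cos_cube_series r x = (\<Sum>n. r ^ n * cos (2 * pi * real n * x) / real n ^ 3)"

lemma summable_inverse_cube: "summable (\<lambda>n. 1 / real n ^ 3)"
  using inverse_power_summable[of 3, where 'a = real] by (simp add: inverse_eq_divide)

lemma norm_cos_cube_le:
  "0 \<le> r \<Longrightarrow> r \<le> 1 \<Longrightarrow> norm (r ^ n * cos (2 * pi * real n * x) / real n ^ 3) \<le> 1 / real n ^ 3"
proof -
  assume "0 \<le> r" "r \<le> 1"
  then have "\<bar>r ^ n\<bar> * \<bar>cos (2 * pi * real n * x)\<bar> \<le> 1 * 1"
    by (intro mult_mono) (auto simp: power_le_one)
  then show ?thesis
    by (auto simp: norm_divide norm_mult abs_mult intro!: divide_right_mono)
qed

lemma cos_cube_series_sums: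
  assumes "0 \<le> r" "r \<le> 1"
  shows "(\<lambda>n. r ^ n * cos (2 * pi * real n * x) / real n ^ 3) sums cos_cube_series r x"
  unfolding cos_cube_series_def
  by (rule summable_sums, rule summable_comparison_test'[OF summable_inverse_cube, of 0])
     (rule norm_cos_cube_le[OF assms])

lemma continuous_on_cos_cube_series:
  "continuous_on ({0..1} \<times> UNIV) (\<lambda>p. cos_cube_series (fst p) (snd p))"
  unfolding cos_cube_series_def
proof (rule uniform_limit_theorem)
  show "uniform_limit ({0..1} \<times> UNIV) (\<lambda>N p. \<Sum>n<N. fst p ^ n * cos (2 * pi * real n * snd p) / real n ^ 3)
     (\<lambda>p. \<Sum>n. fst p ^ n * cos (2 * pi * real n * snd p) / real n ^ 3) sequentially"
    by (rule Weierstrass_m_test[OF _ summable_inverse_cube], rule norm_cos_cube_le) auto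
  show "\<forall>\<^sub>F N in sequentially. continuous_on ({0..1} \<times> UNIV)
          (\<lambda>p. \<Sum>n<N. fst p ^ n * cos (2 * pi * real n * snd p) / real n ^ 3)"
    unfolding divide_inverse by (intro always_eventually allI continuous_intros)
qed simp

lemma r_cis_neq_1:
  assumes "0 \<le> r" "r \<le> 1" "0 < t" "t \<le> 1 / 2"
  shows "of_real r * cis (2 * pi * t) \<noteq> 1"
proof
  assume "of_real r * cis (2 * pi * t) = 1"
  from arg_cong[OF this, of Re] have eq: "r * cos (2 * pi * t) = 1"
    by simp
  have "cos (2 * pi * t) < cos 0"
    using assms by (intro cos_monotone_0_pi) auto
  then have "r * cos (2 * pi * t) < 1"
    using assms mult_left_mono[of "cos (2 * pi * t)" 1 r] by (cases "r = 1") (auto intro: le_less_trans)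
  with eq show False by simp
qed

lemma sums_ln_norm_1_minus:
  assumes "0 \<le> r" "r < 1"
  shows "(\<lambda>n. r ^ n * cos (2 * pi * real n * t) / real n) sums (- ln (norm (1 - of_real r * cis (2 * pi * t))))"
proof -
  define z where "z = of_real r * cis (2 * pi * t)"
  have z: "norm z < 1" using assms by (simp add: z_def norm_mult)
  then have "z \<noteq> 1" by auto
  have "(\<lambda>n. - (z ^ n) / of_nat n) sums ln (1 - z)"
    using Ln_series'[of "- z"] z by simp
  then have "(\<lambda>n. Re (- (z ^ n) / of_nat n)) sums Re (ln (1 - z))"
    by (rule sums_Re)
  moreover have "Re (- (z ^ n) / of_nat n) = - (r ^ n * cos (2 * pi * real n * t) / real n)" for n
  proof -
    have "z ^ n = of_real (r ^ n) * cis (real n * (2 * pi * t))"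
      by (simp only: z_def power_mult_distrib Complex.DeMoivre of_real_power)
    then show ?thesis by (simp add: Re_divide_of_nat mult_ac)
  qed
  ultimately have "(\<lambda>n. - (r ^ n * cos (2 * pi * real n * t) / real n)) sums Re (ln (1 - z))"
    by (simp only:)
  from sums_minus[OF this] show ?thesis
    using \<open>z \<noteq> 1\<close> by (simp add: z_def)
qed

lemma has_integral_linear_cos:
  fixes x :: real
  assumes "n > 0" "x \<le> 1 / 2"
  shows "((\<lambda>t. (t - x) * cos (2 * pi * real n * t)) has_integral
     (cos (2 * pi * real n * (1 / 2)) - cos (2 * pi * real n * x)) / (4 * pi\<^sup>2 * real n ^ 2)) {x..1/2}"
proof -
  define k where "k = 2 * pi * real n"
  have k: "k \<noteq> 0" using assms by (simp add: k_def)
  define F where "F t = (t - x) * sin (k * t) / k + cos (k * t) / k ^ 2" for t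
  have "((\<lambda>t. (t - x) * cos (k * t)) has_integral (F (1 / 2) - F x)) {x..1/2}"
  proof (rule fundamental_theorem_of_calculus)
    fix t
    have "(F has_field_derivative (t - x) * cos (k * t)) (at t within {x..1/2})"
      unfolding F_def[abs_def] using k
      by (auto intro!: derivative_eq_intros simp: field_simps power2_eq_square)
    then show "(F has_vector_derivative (t - x) * cos (k * t)) (at t within {x..1/2})"
      by (simp add: has_real_derivative_iff_has_vector_derivative)
  qed (use assms in auto)
  moreover have "sin (k * (1 / 2)) = 0"
    using sin_npi2[of n] by (simp add: k_def)
  then have "F (1 / 2) - F x = (cos (k * (1 / 2)) - cos (k * x)) / (4 * pi\<^sup>2 * real n ^ 2)"
    by (simp add: F_def k_def power_mult_distrib diff_divide_distrib)
  ultimately show ?thesis by (simp add: k_def)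
qed

text \<open>
  For \<open>r < 1\<close> the series \<open>- ln |1 - r e^{2\<pi>it}| = \<Sum>n. r^n cos(2\<pi>nt) / n\<close> converges uniformly in
  \<open>t\<close> and may be integrated twice term by term. The case \<open>r = 1\<close>, where convergence is only
  conditional, follows by continuity in \<open>r\<close>.
\<close>

lemma cos_cube_series_diff_less_1:
  assumes r: "0 \<le> r" "r < 1" and x: "0 < x" "x \<le> 1 / 2"
  shows "cos_cube_series r x - cos_cube_series r (1 / 2) =
     4 * pi\<^sup>2 * integral {x..1/2} (\<lambda>t. (t - x) * ln (norm (1 - of_real r * cis (2 * pi * t))))"
proof -
  define f where "f n t = (t - x) * (r ^ n * cos (2 * pi * real n * t) / real n)" for n t
  define g where "g t = (t - x) * ln (norm (1 - of_real r * cis (2 * pi * t)))" for t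
  have f_int: "(f n has_integral
      (r ^ n * cos (2 * pi * real n * (1 / 2)) / real n ^ 3 - r ^ n * cos (2 * pi * real n * x) / real n ^ 3)
       / (4 * pi\<^sup>2)) {x..1/2}" for n
  proof (cases "n = 0")
    case True
    then show ?thesis by (simp add: f_def[abs_def])
  next
    case False
    have "((\<lambda>t. r ^ n / real n * ((t - x) * cos (2 * pi * real n * t))) has_integral
       r ^ n / real n * ((cos (2 * pi * real n * (1 / 2)) - cos (2 * pi * real n * x)) / (4 * pi\<^sup>2 * real n ^ 2))) {x..1/2}"
      by (intro has_integral_mult_right has_integral_linear_cos) (use False x in auto)
    moreover have "r ^ n / real n * ((t - x) * cos (2 * pi * real n * t)) = f n t" for t
      by (simp add: f_def)
    moreover have "r ^ n / real n * ((cos (2 * pi * real n * (1 / 2)) - cos (2 * pi * real n * x)) / (4 * pi\<^sup>2 * real n ^ 2))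
      = (r ^ n * cos (2 * pi * real n * (1 / 2)) / real n ^ 3 - r ^ n * cos (2 * pi * real n * x) / real n ^ 3)
       / (4 * pi\<^sup>2)"
      using False by (simp add: field_simps power2_eq_square power3_eq_cube)
    ultimately show ?thesis by simp
  qed
  have fsum: "(\<Sum>n. f n t) = - g t" for t
    using sums_mult[OF sums_ln_norm_1_minus[OF r, of t], of "t - x"]
    by (simp add: f_def g_def sums_iff)
  have "uniform_limit {x..1/2} (\<lambda>N t. \<Sum>n<N. f n t) (\<lambda>t. \<Sum>n. f n t) sequentially"
  proof (rule Weierstrass_m_test)
    show "summable (\<lambda>n. r ^ n)" using r by simp
    fix n t assume t: "t \<in> {x..1/2}"
    have "\<bar>cos (2 * pi * real n * t) / real n\<bar> \<le> 1"
      by (cases "n = 0") (auto simp: divide_simps intro: order_trans[OF abs_cos_le_one])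
    then have "\<bar>t - x\<bar> * (r ^ n * \<bar>cos (2 * pi * real n * t) / real n\<bar>) \<le> 1 * (r ^ n * 1)"
      using t x r by (intro mult_mono mult_left_mono) auto
    then show "norm (f n t) \<le> r ^ n"
      using r by (simp add: f_def abs_mult)
  qed
  then have "uniform_limit {x..1/2} (\<lambda>N t. \<Sum>n<N. f n t) (\<lambda>t. - g t) sequentially"
    by (simp add: fsum)
  moreover have "continuous_on {x..1/2} (\<lambda>t. \<Sum>n<N. f n t)" for N
    unfolding f_def divide_inverse by (intro continuous_intros)
  ultimately obtain I J where IJ: "\<And>N. ((\<lambda>t. \<Sum>n<N. f n t) has_integral I N) {x..1/2}"
     "((\<lambda>t. - g t) has_integral J) {x..1/2}" "I \<longlonglongrightarrow> J"
    using uniform_limit_integral[where a = x and b = "1/2" and f = "\<lambda>N t. \<Sum>n<N. f n t"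
       and g = "\<lambda>t. - g t" and F = sequentially] by auto
  have "((\<lambda>t. \<Sum>n<N. f n t) has_integral (\<Sum>n<N. (r ^ n * cos (2 * pi * real n * (1 / 2)) / real n ^ 3
        - r ^ n * cos (2 * pi * real n * x) / real n ^ 3) / (4 * pi\<^sup>2))) {x..1/2}" for N
    by (intro has_integral_sum f_int) auto
  then have "I N = (\<Sum>n<N. (r ^ n * cos (2 * pi * real n * (1 / 2)) / real n ^ 3
        - r ^ n * cos (2 * pi * real n * x) / real n ^ 3) / (4 * pi\<^sup>2))" for N
    using has_integral_unique[OF IJ(1)] by blast
  then have I: "I = (\<lambda>N. \<Sum>n<N. (r ^ n * cos (2 * pi * real n * (1 / 2)) / real n ^ 3
        - r ^ n * cos (2 * pi * real n * x) / real n ^ 3) / (4 * pi\<^sup>2))"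
    by (rule ext)
  have "I \<longlonglongrightarrow> (cos_cube_series r (1 / 2) - cos_cube_series r x) / (4 * pi\<^sup>2)"
    unfolding I sums_def [symmetric]
    by (intro sums_divide sums_diff cos_cube_series_sums) (use r in auto)
  then have "J = (cos_cube_series r (1 / 2) - cos_cube_series r x) / (4 * pi\<^sup>2)"
    using IJ(3) LIMSEQ_unique by blast
  moreover have "J = - integral {x..1/2} g"
    using integral_unique[OF IJ(2)] by simp
  ultimately have "cos_cube_series r x - cos_cube_series r (1 / 2) = 4 * pi\<^sup>2 * integral {x..1/2} g"
    by (simp add: field_simps)
  then show ?thesis by (simp add: g_def[abs_def])
qed

lemma norm_1_minus_cis:
  assumes "0 \<le> t" "t \<le> 1"
  shows "norm (1 - cis (2 * pi * t)) = 2 * sin (pi * t)"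
proof -
  have s: "sin (pi * t) \<ge> 0"
    using assms by (intro sin_ge_zero) (auto simp: mult_left_le)
  have "(norm (1 - cis (2 * pi * t)))\<^sup>2 = (1 - cos (2 * (pi * t)))\<^sup>2 + (sin (2 * (pi * t)))\<^sup>2"
    by (simp add: cmod_power2 mult_ac)
  also have "\<dots> = 2 - 2 * cos (2 * (pi * t))"
    using sin_cos_squared_add[of "2 * (pi * t)"] by (simp add: power2_diff)
  also have "\<dots> = (2 * sin (pi * t))\<^sup>2"
    unfolding cos_double_sin by (simp add: power_mult_distrib)
  finally show ?thesis
    using s by (metis norm_ge_zero power2_eq_imp_eq zero_le_mult_iff zero_le_numeral)
qed

lemma cos_cube_series_diff:
  assumes x: "0 < x" "x \<le> 1 / 2"
  shows "cos_cube_series 1 x - cos_cube_series 1 (1 / 2) =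
     4 * pi\<^sup>2 * integral {x..1/2} (\<lambda>t. (t - x) * ln (2 * sin (pi * t)))"
proof -
  \<comment> \<open>A sequence in \<open>[0, 1)\<close> tending to \<open>1\<close>.\<close>
  define R where "R n = real n / real (Suc n)" for n
  have R: "R \<longlonglongrightarrow> 1" unfolding R_def by (rule LIMSEQ_n_over_Suc_n)
  have R01: "0 \<le> R n" "R n < 1" for n by (auto simp: R_def)
  define C where "C r = cos_cube_series r x - cos_cube_series r (1 / 2)" for r
  define G where "G r = integral (cbox x (1/2)) (\<lambda>t. (t - x) * ln (norm (1 - of_real r * cis (2 * pi * t))))" for r :: real
  have "continuous_on {0..1} C"
    unfolding C_def
    by (intro continuous_on_diff continuous_on_compose2[OF continuous_on_cos_cube_series, of _ "\<lambda>r. (r, _)", simplified]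
         continuous_intros) auto
  then have "(\<lambda>n. C (R n)) \<longlonglongrightarrow> C 1"
    by (rule continuous_on_tendsto_compose[OF _ R]) (use R01 in \<open>auto intro!: always_eventually less_imp_le\<close>)
  have "continuous_on {0..1} G"
    unfolding G_def
  proof (rule integral_continuous_on_param)
    show "continuous_on ({0..1} \<times> cbox x (1/2)) (\<lambda>(r, t). (t - x) * ln (norm (1 - of_real r * cis (2 * pi * t))))"
      unfolding split_beta
    proof (intro continuous_intros ballI)
      fix p :: "real \<times> real" assume "p \<in> {0..1} \<times> cbox x (1/2)"
      then have "of_real (fst p) * cis (2 * pi * snd p) \<noteq> 1"
        using x by (intro r_cis_neq_1) auto
      then show "norm (1 - of_real (fst p) * cis (2 * pi * snd p)) \<noteq> 0"
        by auto
    qed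
  qed
  then have "(\<lambda>n. G (R n)) \<longlonglongrightarrow> G 1"
    by (rule continuous_on_tendsto_compose[OF _ R]) (use R01 in \<open>auto intro!: always_eventually less_imp_le\<close>)
  then have "(\<lambda>n. 4 * pi\<^sup>2 * G (R n)) \<longlonglongrightarrow> 4 * pi\<^sup>2 * G 1"
    by (rule tendsto_mult_left)
  moreover have "4 * pi\<^sup>2 * G (R n) = C (R n)" for n
    using cos_cube_series_diff_less_1[OF R01 x, of n] by (simp add: C_def G_def)
  ultimately have "C 1 = 4 * pi\<^sup>2 * G 1"
    using \<open>(\<lambda>n. C (R n)) \<longlonglongrightarrow> C 1\<close> LIMSEQ_unique by simp
  moreover have "G 1 = integral {x..1/2} (\<lambda>t. (t - x) * ln (2 * sin (pi * t)))"
    unfolding G_def using x by (auto simp: norm_1_minus_cis intro!: integral_cong)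
  ultimately show ?thesis by (simp add: C_def)
qed

section \<open>The derivative at minus two and the integral\<close>

text \<open>
  The terms with even \<open>n\<close> cancel, and those with odd \<open>n\<close> form \<open>\<zeta>(3, 1/2) / 4\<close>.
\<close>

lemma cos_cube_series_0_half:
  "of_real (cos_cube_series 1 0 - cos_cube_series 1 (1 / 2)) = 7 / 4 * hurwitz_zeta 3 1"
proof -
  define d where "d n = 1 / real n ^ 3 - (- 1) ^ n / real n ^ 3" for n
  have "(\<lambda>n. 1 ^ n * cos (2 * pi * real n * 0) / real n ^ 3 - 1 ^ n * cos (2 * pi * real n * (1 / 2)) / real n ^ 3)
      sums (cos_cube_series 1 0 - cos_cube_series 1 (1 / 2))"
    by (intro sums_diff cos_cube_series_sums) auto
  moreover have "cos (2 * pi * real n * (1 / 2)) = (- 1) ^ n" for n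
    using cos_npi2[of n] by simp
  ultimately have "d sums (cos_cube_series 1 0 - cos_cube_series 1 (1 / 2))"
    by (simp add: d_def[abs_def])
  from sums_group[OF this, of 2]
  have "(\<lambda>n. sum d {n * 2..<n * 2 + 2}) sums (cos_cube_series 1 0 - cos_cube_series 1 (1 / 2))"
    by simp
  moreover have "sum d {n * 2..<n * 2 + 2} = inverse ((1 / 2 + real n) ^ 3) / 4" for n
  proof -
    have "{n * 2..<n * 2 + 2} = {2 * n, Suc (2 * n)}" by auto
    then have "sum d {n * 2..<n * 2 + 2} = 2 / (real (2 * n) + 1) ^ 3"
      by (simp add: d_def add.commute)
    also have "real (2 * n) + 1 = 2 * (1 / 2 + real n)" by simp
    finally show ?thesis by (simp only: power_mult_distrib) (simp add: divide_simps)
  qed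
  ultimately have "(\<lambda>n. inverse ((1 / 2 + real n) ^ 3) / 4) sums (cos_cube_series 1 0 - cos_cube_series 1 (1 / 2))"
    by (simp only:)
  then have "(\<lambda>n. complex_of_real (inverse ((1 / 2 + real n) ^ 3) / 4)) sums
      of_real (cos_cube_series 1 0 - cos_cube_series 1 (1 / 2))"
    by (rule sums_of_real)
  moreover have "(\<lambda>n. complex_of_real (inverse ((1 / 2 + real n) ^ 3)) / 4) sums (hurwitz_zeta (of_nat 3) (1 / 2) / 4)"
    by (intro sums_divide hurwitz_zeta_of_nat_sums) auto
  then have "(\<lambda>n. complex_of_real (inverse ((1 / 2 + real n) ^ 3) / 4)) sums (hurwitz_zeta 3 (1 / 2) / 4)"
    by simp
  ultimately have "of_real (cos_cube_series 1 0 - cos_cube_series 1 (1 / 2)) = hurwitz_zeta 3 (1 / 2) / 4"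
    by (rule sums_unique2)
  moreover have "hurwitz_zeta 3 (1 / 2) + hurwitz_zeta 3 1 = 8 * hurwitz_zeta 3 1"
    using hurwitz_zeta_duplication[of 3] powr_nat'[of "2::complex" 3] by simp
  then have "hurwitz_zeta 3 (1 / 2) = 7 * hurwitz_zeta 3 1"
    by (simp add: algebra_simps)
  ultimately show ?thesis by simp
qed

lemma hurwitz_deriv_even_diff:
  assumes x: "0 < x" "x \<le> 1 / 2"
  shows "hurwitz_deriv_even x - hurwitz_deriv_even (1 / 2) = - of_real ((cos_cube_series 1 x - cos_cube_series 1 (1 / 2)) / (2 * pi\<^sup>2))"
proof -
  \<comment> \<open>As \<open>hurwitz_deriv_odd\<close> vanishes at \<open>1 / 2\<close>, the second-order Taylor formula there is the
    fundamental theorem of calculus for the following function.\<close>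
  define P where "P t = of_real (t - x) * (2 * hurwitz_deriv_odd t) - hurwitz_deriv_even t" for t
  have "((\<lambda>t. - 2 * complex_of_real ((t - x) * ln (2 * sin (pi * t)))) has_integral (P (1 / 2) - P x)) {x..1/2}"
  proof (rule fundamental_theorem_of_calculus)
    fix t assume t: "t \<in> {x..1/2}"
    have t01: "0 < t" "t < 1" using t x by auto
    have "((\<lambda>t. complex_of_real (t - x)) has_vector_derivative 1) (at t)"
      by (auto intro!: derivative_eq_intros)
    moreover have "((\<lambda>t. 2 * hurwitz_deriv_odd t) has_vector_derivative 2 * - of_real (ln (2 * sin (pi * t)))) (at t)"
      by (intro has_vector_derivative_mult_right has_vector_derivative_hurwitz_deriv_odd t01)
    ultimately have "(P has_vector_derivative
        (of_real (t - x) * (2 * - of_real (ln (2 * sin (pi * t)))) + 1 * (2 * hurwitz_deriv_odd t)) - 2 * hurwitz_deriv_odd t) (at t)"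
      unfolding P_def[abs_def]
      by (intro has_vector_derivative_diff has_vector_derivative_mult has_vector_derivative_hurwitz_deriv_even t01)
    also have "(of_real (t - x) * (2 * - of_real (ln (2 * sin (pi * t)))) + 1 * (2 * hurwitz_deriv_odd t)) - 2 * hurwitz_deriv_odd t
       = - 2 * complex_of_real ((t - x) * ln (2 * sin (pi * t)))"
      by (simp add: algebra_simps)
    finally show "(P has_vector_derivative - 2 * complex_of_real ((t - x) * ln (2 * sin (pi * t)))) (at t within {x..1/2})"
      by (rule has_vector_derivative_at_within)
  qed (use x in auto)
  moreover have "hurwitz_deriv_odd (1 / 2) = 0" by (simp add: hurwitz_deriv_odd_def)
  then have "P (1 / 2) - P x = hurwitz_deriv_even x - hurwitz_deriv_even (1 / 2)"
    by (simp add: P_def)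
  ultimately have "hurwitz_deriv_even x - hurwitz_deriv_even (1 / 2)
     = integral {x..1/2} (\<lambda>t. - 2 * complex_of_real ((t - x) * ln (2 * sin (pi * t))))"
    by (simp only: integral_unique)
  also have "\<dots> = - 2 * of_real (integral {x..1/2} (\<lambda>t. (t - x) * ln (2 * sin (pi * t))))"
  proof -
    have "2 * sin (pi * t) \<noteq> 0" if "t \<in> {x..1/2}" for t
      using sin_gt_zero[of "pi * t"] that x by auto
    then have "(\<lambda>t. (t - x) * ln (2 * sin (pi * t))) integrable_on {x..1/2}"
      by (intro integrable_continuous_interval continuous_intros ballI)
    from has_integral_mult_right[OF has_integral_of_real[OF integrable_integral[OF this]], of "- 2"]
    show ?thesis by (rule integral_unique)
  qed
  also have "integral {x..1/2} (\<lambda>t. (t - x) * ln (2 * sin (pi * t)))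
     = (cos_cube_series 1 x - cos_cube_series 1 (1 / 2)) / (4 * pi\<^sup>2)"
    using cos_cube_series_diff[OF x] by simp
  also have "- 2 * complex_of_real (d / (4 * pi\<^sup>2)) = - of_real (d / (2 * pi\<^sup>2))" for d
    by (simp add: field_simps)
  finally show ?thesis .
qed

lemma continuous_on_hurwitz_zeta_deriv:
  "s \<noteq> 1 \<Longrightarrow> continuous_on {0<..} (hurwitz_zeta_deriv s)"
  unfolding hurwitz_zeta_deriv_def[abs_def]
  by (rule holomorphic_family_deriv_compose[OF holomorphic_family_hurwitz_zeta]) (auto intro!: continuous_intros)

lemma tendsto_hurwitz_zeta_deriv:
  assumes "s \<noteq> 1" "x > 0" "(f \<longlongrightarrow> x) F"
  shows "((\<lambda>y. hurwitz_zeta_deriv s (f y)) \<longlongrightarrow> hurwitz_zeta_deriv s x) F"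
proof -
  have "isCont (hurwitz_zeta_deriv s) x"
    using continuous_on_interior[OF continuous_on_hurwitz_zeta_deriv[OF assms(1)], of x] assms(2)
    by (simp add: interior_open)
  then show ?thesis using assms(3) by (rule isCont_tendsto_compose)
qed

lemma tendsto_hurwitz_deriv_even_0: "(hurwitz_deriv_even \<longlongrightarrow> 2 * hurwitz_zeta_deriv (- 2) 1) (at_right 0)"
proof -
  have "((\<lambda>x. complex_of_real (- ln x * x ^ 2) + hurwitz_zeta_deriv (- 2) (x + 1) + hurwitz_zeta_deriv (- 2) (1 - x))
     \<longlongrightarrow> of_real 0 + hurwitz_zeta_deriv (- 2) 1 + hurwitz_zeta_deriv (- 2) 1) (at_right 0)"
  proof (intro tendsto_add tendsto_of_real tendsto_hurwitz_zeta_deriv)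
    show "((\<lambda>x::real. - ln x * x ^ 2) \<longlongrightarrow> 0) (at_right 0)" by real_asymp
  qed (auto intro!: tendsto_eq_intros)
  then have "(hurwitz_deriv_even \<longlongrightarrow> of_real 0 + hurwitz_zeta_deriv (- 2) 1 + hurwitz_zeta_deriv (- 2) 1) (at_right 0)"
  proof (rule Lim_transform_eventually)
    show "\<forall>\<^sub>F x in at_right 0. complex_of_real (- ln x * x ^ 2) + hurwitz_zeta_deriv (- 2) (x + 1)
      + hurwitz_zeta_deriv (- 2) (1 - x) = hurwitz_deriv_even x"
    using eventually_at_right_less[of "0::real"]
  proof eventually_elim
    case (elim x)
    then show ?case
      using hurwitz_zeta_deriv_shift[of x "- 2"] powr_nat'[of "complex_of_real x" 2] by (simp add: hurwitz_deriv_even_def)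
  qed
  qed
  then show ?thesis by (simp only: of_real_0 add_0 mult_2)
qed

lemma tendsto_times_hurwitz_deriv_odd_0: "((\<lambda>x. of_real x * hurwitz_deriv_odd x) \<longlongrightarrow> 0) (at_right 0)"
proof -
  have "((\<lambda>x. complex_of_real (- ln x * x ^ 2) + of_real x * (hurwitz_zeta_deriv (- 1) (x + 1) - hurwitz_zeta_deriv (- 1) (1 - x)))
     \<longlongrightarrow> of_real 0 + of_real 0 * (hurwitz_zeta_deriv (- 1) 1 - hurwitz_zeta_deriv (- 1) 1)) (at_right 0)"
  proof (intro tendsto_add tendsto_of_real tendsto_mult tendsto_diff tendsto_hurwitz_zeta_deriv)
    show "((\<lambda>x::real. - ln x * x ^ 2) \<longlongrightarrow> 0) (at_right 0)" by real_asymp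
  qed (auto intro!: tendsto_eq_intros)
  then have "((\<lambda>x. of_real x * hurwitz_deriv_odd x) \<longlongrightarrow>
      of_real 0 + of_real 0 * (hurwitz_zeta_deriv (- 1) 1 - hurwitz_zeta_deriv (- 1) 1)) (at_right 0)"
  proof (rule Lim_transform_eventually)
    show "\<forall>\<^sub>F x in at_right 0. complex_of_real (- ln x * x ^ 2)
      + of_real x * (hurwitz_zeta_deriv (- 1) (x + 1) - hurwitz_zeta_deriv (- 1) (1 - x)) = of_real x * hurwitz_deriv_odd x"
    using eventually_at_right_less[of "0::real"]
  proof eventually_elim
    case (elim x)
    then have e: "hurwitz_zeta_deriv (- 1) (x + 1) = hurwitz_zeta_deriv (- 1) x + of_real (ln x * x)"
      using hurwitz_zeta_deriv_shift[of x "- 1"] by simp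
    show ?case unfolding hurwitz_deriv_odd_def e by (simp add: algebra_simps power2_eq_square)
  qed
  qed
  then show ?thesis by simp
qed

lemma hurwitz_zeta_deriv_neg2_1:
  "2 * hurwitz_zeta_deriv (- 2) 1 = - hurwitz_zeta 3 1 / (2 * of_real pi ^ 2)"
proof -
  define c where "c = cos_cube_series 1"
  have "continuous_on UNIV (\<lambda>x::real. (1::real, x))"
    by (intro continuous_intros)
  from continuous_on_compose2[OF continuous_on_cos_cube_series this] have "continuous_on UNIV c"
    by (simp add: c_def image_subset_iff)
  then have "isCont c 0"
    by (simp add: continuous_on_eq_continuous_at)
  then have c0: "(c \<longlongrightarrow> c 0) (at_right 0)"
    by (auto simp: isCont_def intro: filterlim_at_split[THEN iffD1, THEN conjunct2])
  have "((\<lambda>x. - complex_of_real ((c x - c (1 / 2)) / (2 * pi\<^sup>2))) \<longlongrightarrow>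
      - of_real ((c 0 - c (1 / 2)) / (2 * pi\<^sup>2))) (at_right 0)"
    by (intro tendsto_intros c0) auto
  then have "((\<lambda>x. hurwitz_deriv_even x - hurwitz_deriv_even (1 / 2)) \<longlongrightarrow> - of_real ((c 0 - c (1 / 2)) / (2 * pi\<^sup>2))) (at_right 0)"
  proof (rule Lim_transform_eventually)
    show "\<forall>\<^sub>F x in at_right 0. - complex_of_real ((c x - c (1 / 2)) / (2 * pi\<^sup>2)) = hurwitz_deriv_even x - hurwitz_deriv_even (1 / 2)"
    proof -
      have "\<forall>\<^sub>F x in at_right 0. x \<in> {0<..<1 / 2 :: real}"
        by (rule eventually_at_right_real) simp
      then show ?thesis by eventually_elim (simp add: hurwitz_deriv_even_diff c_def)
    qed
  qed
  moreover have "((\<lambda>x. hurwitz_deriv_even x - hurwitz_deriv_even (1 / 2)) \<longlongrightarrow> 2 * hurwitz_zeta_deriv (- 2) 1 - hurwitz_deriv_even (1 / 2)) (at_right 0)"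
    by (intro tendsto_intros tendsto_hurwitz_deriv_even_0)
  ultimately have "2 * hurwitz_zeta_deriv (- 2) 1 - hurwitz_deriv_even (1 / 2) = - of_real ((c 0 - c (1 / 2)) / (2 * pi\<^sup>2))"
    using tendsto_unique trivial_limit_at_right_real by blast
  also have "\<dots> = - (7 / 4 * hurwitz_zeta 3 1) / (2 * of_real pi ^ 2)"
    by (simp only: c_def of_real_divide cos_cube_series_0_half) simp
  finally have "2 * hurwitz_zeta_deriv (- 2) 1 - hurwitz_deriv_even (1 / 2) = - (7 / 4 * hurwitz_zeta 3 1) / (2 * of_real pi ^ 2)" .
  moreover have "hurwitz_zeta_deriv (- 2) (1 / 2) = - 3 / 4 * hurwitz_zeta_deriv (- 2) 1"
  proof -
    have "(2::complex) powr (- 2) = 1 / 4"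
      using powr_nat'[of "2::complex" 2] by (simp add: powr_minus inverse_eq_divide)
    then have "hurwitz_zeta_deriv (- 2) (1 / 2) + hurwitz_zeta_deriv (- 2) 1 = 1 / 4 * hurwitz_zeta_deriv (- 2) 1"
      using hurwitz_zeta_deriv_duplication[of "- 2"] by (simp add: hurwitz_zeta_neg2_1)
    then have "hurwitz_zeta_deriv (- 2) (1 / 2) = 1 / 4 * hurwitz_zeta_deriv (- 2) 1 - hurwitz_zeta_deriv (- 2) 1"
      by (simp only: eq_diff_eq)
    then show ?thesis by simp
  qed
  then have "hurwitz_deriv_even (1 / 2) = - 3 / 2 * hurwitz_zeta_deriv (- 2) 1"
    by (simp add: hurwitz_deriv_even_def)
  ultimately have "7 / 4 * (2 * hurwitz_zeta_deriv (- 2) 1) = 7 / 4 * (- hurwitz_zeta 3 1 / (2 * of_real pi ^ 2))"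
    by simp
  then show ?thesis by (simp only: mult_cancel_left) simp
qed

theorem mainTheorem5:
  fixes x :: real
  assumes "0 < x" and "x < 1"
  shows "((\<lambda>u. complex_of_real (if u = 0 then 0 else pi * u\<^sup>2 * cot (pi * u))) has_integral
           (- (hurwitz_zeta_deriv (-2) x + hurwitz_zeta_deriv (-2) (1 - x))
            + 2 * complex_of_real x * (hurwitz_zeta_deriv (-1) x - hurwitz_zeta_deriv (-1) (1 - x))
            + complex_of_real (x\<^sup>2 * ln (2 * sin (pi * x)))
            - riemann_zeta 3 / (2 * complex_of_real pi ^ 2))) {0..x}"
proof -
  define R where "R u = - hurwitz_deriv_even u + 2 * (of_real u * hurwitz_deriv_odd u) + complex_of_real (u\<^sup>2 * ln (2 * sin (pi * u)))
     - riemann_zeta 3 / (2 * of_real pi ^ 2)" for u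
  \<comment> \<open>At \<open>u = 0\<close> the formula for \<open>R\<close> involves \<open>\<zeta>'(-1, 0)\<close> and \<open>\<zeta>'(-2, 0)\<close>, which carry no
    information here, so the limit \<open>0\<close> is taken as the value instead.\<close>
  define R0 where "R0 u = (if u = 0 then 0 else R u)" for u
  define f where "f u = complex_of_real (if u = 0 then 0 else pi * u\<^sup>2 * cot (pi * u))" for u
  have dR: "(R has_vector_derivative f u) (at u)" if u: "0 < u" "u < 1" for u
  proof -
    have s: "sin (pi * u) > 0" using u by (intro sin_gt_zero) auto
    have "((\<lambda>u. u\<^sup>2) has_real_derivative 2 * u) (at u)"
      by (auto intro!: derivative_eq_intros)
    moreover have "((\<lambda>u. ln (2 * sin (pi * u))) has_real_derivative pi * cot (pi * u)) (at u)"
      using s by (auto intro!: derivative_eq_intros simp: cot_def)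
    ultimately have "((\<lambda>u. u\<^sup>2 * ln (2 * sin (pi * u))) has_real_derivative
        2 * u * ln (2 * sin (pi * u)) + pi * cot (pi * u) * u\<^sup>2) (at u)"
      by (rule DERIV_mult)
    then have "((\<lambda>u. u\<^sup>2 * ln (2 * sin (pi * u))) has_real_derivative
        2 * u * ln (2 * sin (pi * u)) + pi * u\<^sup>2 * cot (pi * u)) (at u)"
      by (simp add: mult_ac)
    then have L: "((\<lambda>u. complex_of_real (u\<^sup>2 * ln (2 * sin (pi * u)))) has_vector_derivative
        of_real (2 * u * ln (2 * sin (pi * u)) + pi * u\<^sup>2 * cot (pi * u))) (at u)"
      by (intro has_vector_derivative_of_real) (simp add: has_real_derivative_iff_has_vector_derivative)
    have "((\<lambda>u. complex_of_real u) has_vector_derivative 1) (at u)"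
      by (auto intro!: derivative_eq_intros)
    from has_vector_derivative_mult[OF this has_vector_derivative_hurwitz_deriv_odd[OF u]]
    have O: "((\<lambda>u. of_real u * hurwitz_deriv_odd u) has_vector_derivative
        of_real u * - of_real (ln (2 * sin (pi * u))) + 1 * hurwitz_deriv_odd u) (at u)" .
    have "(R has_vector_derivative - (2 * hurwitz_deriv_odd u)
        + 2 * (of_real u * - of_real (ln (2 * sin (pi * u))) + 1 * hurwitz_deriv_odd u)
        + of_real (2 * u * ln (2 * sin (pi * u)) + pi * u\<^sup>2 * cot (pi * u)) - 0) (at u)"
      unfolding R_def[abs_def]
      by (intro has_vector_derivative_diff has_vector_derivative_add has_vector_derivative_minus
           has_vector_derivative_mult_right has_vector_derivative_const L O has_vector_derivative_hurwitz_deriv_even u)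
    then show ?thesis using u by (simp add: f_def algebra_simps)
  qed
  have "(R \<longlongrightarrow> - (2 * hurwitz_zeta_deriv (- 2) 1) + 2 * 0 + of_real 0 - riemann_zeta 3 / (2 * of_real pi ^ 2)) (at_right 0)"
    unfolding R_def[abs_def]
  proof (intro tendsto_diff tendsto_add tendsto_minus tendsto_mult_left tendsto_const tendsto_of_real
      tendsto_hurwitz_deriv_even_0 tendsto_times_hurwitz_deriv_odd_0)
    show "((\<lambda>u. u\<^sup>2 * ln (2 * sin (pi * u))) \<longlongrightarrow> 0) (at_right 0)" by real_asymp
  qed
  then have R_0: "(R \<longlongrightarrow> 0) (at_right 0)"
    unfolding hurwitz_zeta_deriv_neg2_1 by (simp add: riemann_zeta_eq_hurwitz_zeta)
  have dR0: "(R0 has_vector_derivative f u) (at u)" if u: "0 < u" "u < 1" for u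
    by (rule has_vector_derivative_transform_within_open[OF dR[OF u], of "{0<..}"])
       (use u in \<open>auto simp: R0_def\<close>)
  have "continuous (at u within {0..x}) R0" if u: "u \<in> {0..x}" for u
  proof (cases "u = 0")
    case True
    have "(R0 \<longlongrightarrow> 0) (at_right 0)"
      using R_0
    proof (rule Lim_transform_eventually)
      show "\<forall>\<^sub>F u in at_right 0. R u = R0 u"
        using eventually_at_right_less[of "0::real"] by eventually_elim (simp add: R0_def)
    qed
    then have "(R0 \<longlongrightarrow> 0) (at 0 within {0..x})"
      using assms by (simp add: at_within_Icc_at_right)
    then show ?thesis using True by (simp add: continuous_within R0_def)
  next
    case False
    then have "(R0 has_vector_derivative f u) (at u)"
      using u assms by (intro dR0) auto
    from has_vector_derivative_continuous[OF this] show ?thesis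
      by (rule continuous_at_imp_continuous_at_within)
  qed
  then have "continuous_on {0..x} R0"
    by (simp add: continuous_on_eq_continuous_within)
  moreover have "(R0 has_vector_derivative f u) (at u)" if "u \<in> {0<..<x}" for u
    using that assms by (intro dR0) auto
  ultimately have "(f has_integral (R0 x - R0 0)) {0..x}"
    using assms by (intro fundamental_theorem_of_calculus_interior) auto
  moreover have "R0 x - R0 0 = - (hurwitz_zeta_deriv (-2) x + hurwitz_zeta_deriv (-2) (1 - x))
            + 2 * complex_of_real x * (hurwitz_zeta_deriv (-1) x - hurwitz_zeta_deriv (-1) (1 - x))
            + complex_of_real (x\<^sup>2 * ln (2 * sin (pi * x)))
            - riemann_zeta 3 / (2 * complex_of_real pi ^ 2)"
    using assms by (simp add: R0_def R_def hurwitz_deriv_even_def hurwitz_deriv_odd_def mult.assoc)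
  ultimately show ?thesis
    unfolding f_def[abs_def] by (simp only:)
qed

end
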